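(* For every integer $n\ge0$, the inverse Kazhdan--Lusztig polynomial of the thagomizer matroid $T_n$ is $$Q_{T_n}(t)=\sum_{k=0}^{\lfloor n/2\rfloor}\ \sum_{i=2k}^{n}\frac{n-i+1}{n+1}\binom{n+1}{k,\ i-2k,\ n+k-i+1}t^k ,$$ where $\binom{n+1}{a,b,c}=\frac{(n+1)!}{a!\,b!\,c!}$ is a multinomial coefficient.
   Context: The thagomizer matroid $T_n$ is the graphic matroid of $K_{1,1,n}$ (vertices $A,B,1,\dots,n$, edges $AB,Aj,Bj$ for $1\le j\le n$). For a loopless matroid $\mathrm M$ with lattice of flats $\mathcal L(\mathrm M)$, characteristic polynomial $\chi_{\mathrm M}(t)$, restriction $\mathrm M|_F$ and contraction $\mathrm M/F$, the inverse Kazhdan--Lusztig polynomial $Q_{\mathrm M}(t)\in\mathbb Z[t]$ is the unique polynomial with: $Q_{\mathrm M}=1$ if $\operatorname{rk}\mathrm M=0$; $\deg Q_{\mathrm M}<\tfrac12\operatorname{rk}\mathrm M$ if $\operatorname{rk}\mathrm M>0$; and $t^{\operatorname{rk}\mathrm M}(-1)^{\operatorname{rk}\mathrm M}Q_{\mathrm M}(t^{-1})=\sum_{F\in\mathcal L(\mathrm M)}(-1)^{\operatorname{rk}\mathrm M|_F}Q_{\mathrm M|_F}(t)\,t^{\operatorname{rk}\mathrm M/F}\chi_{\mathrm M/F}(t^{-1})$. *)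

theory Defs
  imports Complex_Main "HOL-Computational_Algebra.Polynomial"
begin

text \<open>The record only carries the data (ground set, independent sets); the notions below agree with
  the usual ones for finite ground sets and independent sets satisfying the matroid axioms.\<close>

record 'a matroid =
  ground :: "'a set"
  indep :: "'a set set"

definition rk :: "'a matroid \<Rightarrow> nat" where
  "rk M = Max (card ` indep M)"

definition restriction :: "'a matroid \<Rightarrow> 'a set \<Rightarrow> 'a matroid" where
  "restriction M F = \<lparr>ground = F, indep = {I \<in> indep M. I \<subseteq> F}\<rparr>"

definition bases :: "'a matroid \<Rightarrow> 'a set set" where
  "bases M = {B \<in> indep M. \<forall>I \<in> indep M. B \<subseteq> I \<longrightarrow> I = B}"

definition contraction :: "'a matroid \<Rightarrow> 'a set \<Rightarrow> 'a matroid" where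
  "contraction M F = \<lparr>ground = ground M - F,
     indep = {I. I \<subseteq> ground M - F \<and> (\<exists>B \<in> bases (restriction M F). I \<union> B \<in> indep M)}\<rparr>"

definition flats :: "'a matroid \<Rightarrow> 'a set set" where
  "flats M = {F. F \<subseteq> ground M \<and>
     (\<forall>x \<in> ground M - F. rk (restriction M F) < rk (restriction M (insert x F)))}"

text \<open>The Moebius function of a family \<open>L\<close> of finite sets, ordered by inclusion.\<close>

function moebius :: "'a set set \<Rightarrow> 'a set \<Rightarrow> 'a set \<Rightarrow> int" where
  "moebius L X Y =
     (if X = Y then (if X \<in> L then 1 else 0)
      else if X \<subset> Y \<and> finite Y
        then - (\<Sum>Z \<in> {Z \<in> L. X \<subseteq> Z \<and> Z \<subset> Y}. moebius L X Z)
      else 0)"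
  by pat_completeness auto
termination
  by (relation "measure (\<lambda>(L, X, Y). card Y)") (auto intro: psubset_card_mono)

declare moebius.simps [simp del]

text \<open>In a loopless matroid the least flat is the empty set. If there are loops, the empty set
  is not a flat and the formula gives the usual value 0.\<close>

definition char_poly :: "'a matroid \<Rightarrow> int poly" where
  "char_poly M = (\<Sum>F \<in> flats M. monom (moebius (flats M) {} F) (rk M - rk (restriction M F)))"

text \<open>For a polynomial \<open>p\<close> of degree at most \<open>r\<close>, \<open>reversal r p\<close> is \<open>t\<^sup>r p(t\<^sup>-\<^sup>1)\<close>.\<close>

definition reversal :: "nat \<Rightarrow> 'a::comm_semiring_1 poly \<Rightarrow> 'a poly" where
  "reversal r p = monom 1 (r - degree p) * reflect_poly p"

lemma poly_reversal:
  fixes p :: "'a::field poly"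
  assumes "degree p \<le> r" "t \<noteq> 0"
  shows "poly (reversal r p) t = t ^ r * poly p (inverse t)"
  using assms
  by (simp add: reversal_def poly_monom poly_reflect_poly_nz mult.assoc [symmetric]
      flip: power_add)

lemma coeff_reversal:
  assumes "degree p \<le> r"
  shows "coeff (reversal r p) i = (if i \<le> r then coeff p (r - i) else 0)"
  using assms
  by (auto simp: reversal_def coeff_monom_mult coeff_reflect_poly coeff_eq_0 not_less)

lemma reversal_diff_unique:
  fixes p q :: "int poly"
  assumes "2 * degree p < r" "2 * degree q < r" "reversal r p - p = reversal r q - q"
  shows "p = q"
proof (rule poly_eqI)
  fix i
  show "coeff p i = coeff q i"
  proof (cases "2 * i < r")
    case True
    then have "coeff p (r - i) = 0" "coeff q (r - i) = 0"
      using assms by (auto intro!: coeff_eq_0)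
    moreover have "coeff (reversal r p - p) (r - i) = coeff (reversal r q - q) (r - i)"
      by (simp only: assms(3))
    ultimately show ?thesis
      using True assms(1,2) by (simp add: coeff_reversal)
  next
    case False
    then show ?thesis using assms by (simp add: coeff_eq_0)
  qed
qed

text \<open>The flat \<open>F = ground M\<close> contributes the unknown polynomial \<open>q\<close> itself to the right-hand
  side of the defining identity; all other flats are proper subsets of the ground set. The value
  for an infinite ground set is irrelevant and only ensures termination. The description below has at most one solution by
  \<open>reversal_diff_unique\<close>.\<close>

function inverse_KL :: "'a matroid \<Rightarrow> int poly" where
  "inverse_KL M =
     (if infinite (ground M) then 0
      else if rk M = 0 then 1
      else (THE q. 2 * degree q < rk M \<and>
        (-1) ^ rk M * reversal (rk M) q =
        (\<Sum>F \<in> flats M. (-1) ^ rk (restriction M F)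
           * (if F = ground M then q else inverse_KL (restriction M F))
           * reversal (rk (contraction M F)) (char_poly (contraction M F)))))"
  by pat_completeness auto
termination
  by (relation "measure (\<lambda>M. card (ground M))")
     (auto simp: restriction_def flats_def intro!: psubset_card_mono)

declare inverse_KL.simps [simp del]

text \<open>A simple graph is given by its set of edges, each edge being the set of its two ends; a
  cycle is given by the cyclic sequence of its (distinct) vertices.\<close>

definition cycle_edges :: "'v list \<Rightarrow> 'v set set" where
  "cycle_edges vs = {{vs ! i, vs ! (Suc i mod length vs)} | i. i < length vs}"

definition forest :: "'v set set \<Rightarrow> bool" where
  "forest S \<longleftrightarrow> \<not> (\<exists>vs. 3 \<le> length vs \<and> distinct vs \<and> cycle_edges vs \<subseteq> S)"

definition graphic_matroid :: "'v set set \<Rightarrow> 'v set matroid" where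
  "graphic_matroid E = \<lparr>ground = E, indep = {S. S \<subseteq> E \<and> forest S}\<rparr>"

datatype thag_vertex = A | B | Spike nat

definition thagomizer_graph :: "nat \<Rightarrow> thag_vertex set set" where
  "thagomizer_graph n =
     {{A, B}} \<union> (\<lambda>j. {A, Spike j}) ` {1..n} \<union> (\<lambda>j. {B, Spike j}) ` {1..n}"

definition thagomizer :: "nat \<Rightarrow> thag_vertex set matroid" where
  "thagomizer n = graphic_matroid (thagomizer_graph n)"

end

theory Submission
  imports Defs
begin

text \<open>
  A set of edges of the thagomizer graph on the spikes \<open>S\<close> consists of the edges from \<open>A\<close> to the
  spikes in \<open>P\<close>, those from \<open>B\<close> to the spikes in \<open>Q\<close>, and possibly \<open>AB\<close>. The flats that contain
  \<open>AB\<close> are those with \<open>P = Q = T\<close>, and the restriction to such a flat is the thagomizer matroid on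
  \<open>T\<close>. The other flats are those with \<open>P\<close> and \<open>Q\<close> disjoint, and the restriction is Boolean, with
  inverse Kazhdan--Lusztig polynomial 1. The reversed characteristic polynomials \<open>p\<^sub>F\<close> of the
  contractions \<open>M/F\<close> of a matroid are characterized by \<open>(\<Sum>G\<supseteq>F. t\<^bsup>rk G - rk F\<^esup> p\<^sub>G) = 1\<close>, so the
  binomial theorem shows that they are \<open>(1 - t)\<^bsup>n-|T|\<^esup>\<close> for the flats containing \<open>AB\<close> and
  \<open>(1 - t) (1 - 2t)\<^bsup>n-|P|-|Q|\<^esup>\<close> for the others, where \<open>n = |S|\<close>.

  The defining identity of the polynomial \<open>q\<^sub>S\<close> in question becomes
  \<open>t\<^bsup>n+1\<^esup> q\<^sub>S(1/t) = (\<Sum>T\<subseteq>S. (t - 1)\<^bsup>n-|T|\<^esup> q\<^sub>T(t)) + (t - 1) (1 + 2t)\<^bsup>n\<^esup>\<close>.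
  The binomial transform \<open>q\<^sub>S = (\<Sum>U\<subseteq>S. R\<^bsub>|U|\<^esub>)\<close> simplifies it to
  \<open>R\<^sub>u(t) - t\<^bsup>u+1\<^esup> R\<^sub>u(1/t) = (1 - t) (1 + t)\<^bsup>u\<^esup>\<close>. The right-hand side is antipalindromic,
  so \<open>R\<^sub>u\<close> is its lower half, whose coefficients are the ballot numbers; multiplied by binomial
  coefficients they are the multinomial expression of the theorem.
\<close>

section \<open>Reversals of polynomials\<close>

lemma reversal_0 [simp]: "reversal r 0 = 0"
  by (simp add: reversal_def)

lemma reversal_1: "reversal r 1 = monom 1 r"
  by (simp add: reversal_def)

lemma reversal_sum:
  assumes "\<And>i. i \<in> I \<Longrightarrow> degree (p i) \<le> r"
  shows "reversal r (\<Sum>i\<in>I. p i) = (\<Sum>i\<in>I. reversal r (p i))"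
proof (cases "finite I")
  case True
  then have "degree (\<Sum>i\<in>I. p i) \<le> r" using assms by (intro degree_sum_le)
  then show ?thesis using assms by (intro poly_eqI) (auto simp: coeff_reversal coeff_sum)
qed simp

lemma reversal_monom:
  assumes "d \<le> r"
  shows "reversal r (monom c (r - d)) = monom c d"
proof (rule poly_eqI)
  fix i
  have "degree (monom c (r - d)) \<le> r"
    using degree_monom_le diff_le_self by (rule order_trans)
  then show "coeff (reversal r (monom c (r - d))) i = coeff (monom c d) i"
    using assms by (auto simp: coeff_reversal)
qed

lemma reversal_mult:
  fixes p q :: "'a::idom poly"
  assumes "degree p \<le> m" "degree q \<le> n"
  shows "reversal (m + n) (p * q) = reversal m p * reversal n q"
proof (cases "p = 0 \<or> q = 0")
  case False
  then have "m + n - degree (p * q) = (m - degree p) + (n - degree q)"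
    using assms by (simp add: degree_mult_eq)
  then have "monom (1::'a) (m + n - degree (p * q)) =
      monom 1 (m - degree p) * monom 1 (n - degree q)"
    by (simp add: mult_monom)
  then show ?thesis by (simp add: reversal_def reflect_poly_mult mult_ac)
qed auto

lemma reversal_power:
  fixes p :: "'a::idom poly"
  assumes "degree p \<le> r"
  shows "reversal (n * r) (p ^ n) = reversal r p ^ n"
proof (induction n)
  case (Suc n)
  have "degree (p ^ n) \<le> n * r"
    using degree_power_le[of p n] mult_le_mono2[OF assms, of n] by (metis mult.commute order_trans)
  then show ?case using assms Suc by (simp add: reversal_mult)
qed (simp add: reversal_1)

lemma reversal_poly_cutoff_half:
  fixes p :: "'a::{idom,ring_char_0} poly"
  assumes deg: "degree p \<le> r" and anti: "reversal r p = - p"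
  defines "h \<equiv> poly_cutoff (Suc r div 2) p"
  shows "reversal r h = h - p"
proof (rule poly_eqI)
  fix k
  have coeff_h: "coeff h k = (if 2 * k < r then coeff p k else 0)" for k
    by (auto simp: h_def coeff_poly_cutoff)
  have anti_coeff: "coeff p (r - k) = - coeff p k" if "k \<le> r" for k
    using that coeff_reversal[OF deg, of k] by (simp add: anti)
  have "degree h \<le> r"
    using deg by (intro degree_le) (simp add: coeff_h coeff_eq_0)
  moreover have "(if k \<le> r then coeff h (r - k) else 0) = coeff h k - coeff p k"
  proof -
    consider (below) "2 * k < r" | (middle) "2 * k = r" | (above) "2 * k > r" "k \<le> r"
      | (outside) "k > r" by linarith
    then show ?thesis
    proof cases
      case middle
      then have "r - k = k" by simp
      then have "coeff p k = 0" using middle anti_coeff[of k] by simp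
      with middle show ?thesis by (simp add: coeff_h)
    qed (use deg in \<open>simp_all add: coeff_h anti_coeff coeff_eq_0\<close>)
  qed
  ultimately show "coeff (reversal r h) k = coeff (h - p) k"
    by (simp add: coeff_reversal)
qed

section \<open>Sums over intervals of sets\<close>

lemma finite_set_interval:
  fixes X Y :: "'a set"
  assumes "finite Y"
  shows "finite {X..Y}"
  by (rule finite_subset[of _ "Pow Y"]) (use assms in auto)

lemma set_interval_empty_eq_Pow: "{{}..X} = Pow X"
  by auto

lemma sum_Pow_power:
  fixes a b :: "'a::comm_semiring_1"
  assumes "finite S"
  shows "(\<Sum>X\<in>Pow S. a ^ card X * b ^ card (S - X)) = (a + b) ^ card S"
  using prod_add[OF assms, of "\<lambda>_. a" "\<lambda>_. b"] by simp

lemma sum_set_interval_power: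
  fixes a b :: "'a::comm_semiring_1"
  assumes "finite Y" "X \<subseteq> Y"
  shows "(\<Sum>Z\<in>{X..Y}. a ^ card (Z - X) * b ^ card (Y - Z)) = (a + b) ^ card (Y - X)"
proof -
  have "(\<Sum>Z\<in>{X..Y}. a ^ card (Z - X) * b ^ card (Y - Z)) =
      (\<Sum>W\<in>Pow (Y - X). a ^ card W * b ^ card (Y - X - W))"
  proof (rule sum.reindex_bij_witness[of _ "\<lambda>W. X \<union> W" "\<lambda>Z. Z - X"])
    fix Z assume "Z \<in> {X..Y}"
    then have "Y - X - (Z - X) = Y - Z" by auto
    then show "a ^ card (Z - X) * b ^ card (Y - X - (Z - X)) = a ^ card (Z - X) * b ^ card (Y - Z)"
      by simp
  qed (use assms(2) in auto)
  then show ?thesis using assms(1) by (simp add: sum_Pow_power)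
qed

lemma sum_set_interval_power_X_one_minus_X:
  assumes "finite Y" "X \<subseteq> Y"
  shows "(\<Sum>Z\<in>{X..Y}. [:0, 1:] ^ card (Z - X) * [:1, -1::int:] ^ card (Y - Z)) = 1"
proof -
  have "[:0, 1:] + [:1, -1::int:] = 1" by (simp add: one_pCons)
  then show ?thesis
    unfolding sum_set_interval_power[OF assms] by (simp only: power_one)
qed

lemma sum_disjoint_set_intervals_power:
  fixes a b c :: "'a::comm_semiring_1"
  assumes "finite S" "P \<subseteq> S" "Q \<subseteq> S" "P \<inter> Q = {}"
  shows "(\<Sum>U\<in>{P..S - Q}. \<Sum>V\<in>{Q..S - U}.
      a ^ card (U - P) * b ^ card (V - Q) * c ^ card (S - (U \<union> V))) =
    (a + b + c) ^ card (S - (P \<union> Q))"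
proof -
  have "(\<Sum>U\<in>{P..S - Q}. \<Sum>V\<in>{Q..S - U}.
        a ^ card (U - P) * b ^ card (V - Q) * c ^ card (S - (U \<union> V))) =
      (\<Sum>U\<in>{P..S - Q}. a ^ card (U - P) * (b + c) ^ card (S - Q - U))"
  proof (rule sum.cong[OF refl])
    fix U assume "U \<in> {P..S - Q}"
    then have "Q \<subseteq> S - U" using assms(3) by auto
    moreover have "S - U - Q = S - Q - U" "S - (U \<union> V) = S - U - V" for V by auto
    ultimately show "(\<Sum>V\<in>{Q..S - U}. a ^ card (U - P) * b ^ card (V - Q) * c ^ card (S - (U \<union> V))) =
        a ^ card (U - P) * (b + c) ^ card (S - Q - U)"
      using sum_set_interval_power[of "S - U" Q b c] assms(1)
      by (simp add: mult.assoc flip: sum_distrib_left)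
  qed
  also have "\<dots> = (a + (b + c)) ^ card (S - Q - P)"
    using assms by (intro sum_set_interval_power) auto
  also have "S - Q - P = S - (P \<union> Q)" by auto
  finally show ?thesis by (simp only: add.assoc)
qed

lemma sum_Pow_binomial_transform:
  fixes a b :: "'a::comm_semiring_1"
  assumes "finite S"
  shows "(\<Sum>T\<in>Pow S. a ^ card T * b ^ card (S - T) * (\<Sum>U\<in>Pow T. f U)) =
    (\<Sum>U\<in>Pow S. a ^ card U * (a + b) ^ card (S - U) * f U)"
proof -
  let ?w = "\<lambda>T. a ^ card T * b ^ card (S - T)"
  have "(\<Sum>T\<in>Pow S. ?w T * (\<Sum>U\<in>Pow T. f U)) =
      (\<Sum>T\<in>Pow S. \<Sum>U\<in>{U. U \<in> Pow S \<and> U \<subseteq> T}. ?w T * f U)"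
    unfolding sum_distrib_left by (intro sum.cong refl) auto
  also have "\<dots> = (\<Sum>U\<in>Pow S. \<Sum>T\<in>{T. T \<in> Pow S \<and> U \<subseteq> T}. ?w T * f U)"
    using assms by (intro sum.swap_restrict) simp_all
  also have "\<dots> = (\<Sum>U\<in>Pow S. (\<Sum>T\<in>{U..S}. a ^ card (T - U) * b ^ card (S - T)) * (a ^ card U * f U))"
    unfolding sum_distrib_right
  proof (intro sum.cong refl)
    fix U T assume "T \<in> {U..S}"
    then have "U \<subseteq> T" "finite T" using assms finite_subset by auto
    then have "a ^ card T = a ^ card (T - U) * a ^ card U"
      by (simp add: card_Diff_subset card_mono finite_subset flip: power_add)
    then show "?w T * f U = a ^ card (T - U) * b ^ card (S - T) * (a ^ card U * f U)"
      by (simp add: mult_ac)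
  qed auto
  also have "\<dots> = (\<Sum>U\<in>Pow S. (a + b) ^ card (S - U) * (a ^ card U * f U))"
    by (intro sum.cong refl) (simp add: sum_set_interval_power assms)
  finally show ?thesis by (simp add: mult_ac)
qed

lemma sum_Pow_card:
  fixes f :: "nat \<Rightarrow> 'a::semiring_1"
  assumes "finite S"
  shows "(\<Sum>U\<in>Pow S. f (card U)) = (\<Sum>s\<le>card S. of_nat (card S choose s) * f s)"
proof -
  have "(\<Sum>U\<in>Pow S. f (card U)) =
      (\<Sum>s\<le>card S. \<Sum>U\<in>{U \<in> Pow S. card U = s}. f (card U))"
    using assms by (intro sum.group[symmetric]) (auto intro: card_mono)
  also have "\<dots> = (\<Sum>s\<le>card S. \<Sum>U\<in>{U. U \<subseteq> S \<and> card U = s}. f s)"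
    by (intro sum.cong) auto
  finally show ?thesis by (simp add: n_subsets[OF assms])
qed

section \<open>Ballot polynomials\<close>

text \<open>The lower half of the antipalindromic polynomial \<open>(1 - t) (1 + t)\<^sup>u\<close>.\<close>

definition ballot_poly :: "nat \<Rightarrow> int poly" where
  "ballot_poly u = poly_cutoff (Suc (u div 2)) ([:1, -1:] * [:1, 1:] ^ u)"

lemma degree_ballot_poly: "degree (ballot_poly u) \<le> u div 2"
  by (rule degree_le) (auto simp: ballot_poly_def coeff_poly_cutoff)

lemma reversal_ballot_poly:
  "reversal (Suc u) (ballot_poly u) = ballot_poly u - [:1, -1:] * [:1, 1:] ^ u"
proof -
  have deg: "degree ([:1, 1::int:] ^ u) \<le> u"
    using degree_power_le[of "[:1, 1::int:]" u] by simp
  have "reversal 1 [:1, -1::int:] = - [:1, -1:]" "reversal 1 [:1, 1::int:] = [:1, 1:]"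
    by (simp_all add: reversal_def reflect_poly_pCons)
  then have "reversal (1 + u) ([:1, -1::int:] * [:1, 1:] ^ u) = - ([:1, -1:] * [:1, 1:] ^ u)"
    using reversal_power[of "[:1, 1::int:]" 1 u] deg by (subst reversal_mult) simp_all
  moreover have "degree ([:1, -1::int:] * [:1, 1:] ^ u) \<le> Suc u"
    using degree_mult_le[of "[:1, -1::int:]" "[:1, 1:] ^ u"] deg by simp
  ultimately show ?thesis
    using reversal_poly_cutoff_half[of "[:1, -1::int:] * [:1, 1:] ^ u" "Suc u"]
    by (simp add: ballot_poly_def)
qed

lemma ballot_coeff_absorption:
  fixes u k :: nat
  assumes "k \<le> u"
  shows "int (u - k + 1) * coeff ([:1, -1:] * [:1, 1:] ^ u) k =
    (int u + 1 - 2 * int k) * int (u choose k)"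
proof (cases k)
  case 0
  then show ?thesis by (simp add: coeff_linear_poly_power)
next
  case (Suc j)
  have coeff: "coeff ([:1, -1:] * [:1, 1:] ^ u) k = int (u choose k) - int (u choose j)"
    using assms Suc by (simp add: coeff_linear_poly_power)
  have "k * (u choose k) = (u - k + 1) * (u choose j)"
    using binomial_absorption[of j u] binomial_absorb_comp[of u j] assms Suc
    by (simp add: Suc_diff_Suc del: mult_Suc)
  then have absorb: "int (u - k + 1) * int (u choose j) = int k * int (u choose k)"
    by (metis of_nat_mult)
  have "int (u - k + 1) = int u + 1 - int k" using assms by simp
  then show ?thesis
    unfolding coeff right_diff_distrib absorb by (simp add: algebra_simps)
qed

lemma binomial_times_ballot_coeff:
  fixes n s k :: nat
  assumes "2 * k \<le> s" "s \<le> n"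
  shows "of_nat (n choose s) * of_int (coeff (ballot_poly s) k) =
    (of_nat (s - 2 * k + 1) / of_nat (n + 1) *
      (fact (n + 1) / (fact k * fact (n - s) * fact (s - k + 1))) :: 'a::field_char_0)"
proof -
  have "k \<le> s" "k < Suc (s div 2)" using assms by auto
  let ?c = "of_int (coeff (ballot_poly s) k) :: 'a"
  have "int (s - k + 1) * coeff (ballot_poly s) k = int (s - 2 * k + 1) * int (s choose k)"
    using ballot_coeff_absorption[OF \<open>k \<le> s\<close>] \<open>k < Suc (s div 2)\<close> assms
    by (simp add: ballot_poly_def coeff_poly_cutoff of_nat_diff)
  then have "of_nat (s - k + 1) * ?c = of_nat (s - 2 * k + 1) * of_nat (s choose k)"
    by (metis of_int_mult of_int_of_nat_eq)
  then have "?c = of_nat (s - 2 * k + 1) * of_nat (s choose k) / of_nat (s - k + 1)"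
    by (simp add: nonzero_eq_divide_eq mult.commute del: of_nat_Suc of_nat_add flip: Suc_eq_plus1)
  also have "of_nat (s choose k) = (fact s / (fact k * fact (s - k)) :: 'a)"
    using \<open>k \<le> s\<close> by (rule binomial_fact)
  finally have "?c = of_nat (s - 2 * k + 1) * fact s / (fact k * fact (s - k + 1))"
    by (simp add: mult_ac del: of_nat_Suc of_nat_add flip: Suc_eq_plus1)
  moreover have "of_nat (n choose s) = (fact n / (fact s * fact (n - s)) :: 'a)"
    using assms by (intro binomial_fact)
  moreover have "fact (n + 1) = of_nat (n + 1) * (fact n :: 'a)" by simp
  ultimately show ?thesis
    by (simp del: of_nat_Suc of_nat_add fact_Suc add: mult_ac)
qed

section \<open>Finite matroids\<close>

lemma rk_restriction_eqI:
  assumes "I \<in> indep M" "I \<subseteq> X" "\<And>J. J \<in> indep M \<Longrightarrow> J \<subseteq> X \<Longrightarrow> card J \<le> card I"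
  shows "rk (restriction M X) = card I"
  unfolding rk_def
proof (rule Max_eqI)
  have "card ` indep (restriction M X) \<subseteq> {..card I}"
    using assms(3) by (auto simp: restriction_def)
  then show "finite (card ` indep (restriction M X))" by (rule finite_subset) simp
qed (use assms in \<open>auto simp: restriction_def\<close>)

lemma restriction_ground:
  assumes "indep M \<subseteq> Pow (ground M)"
  shows "restriction M (ground M) = M"
  using assms by (intro matroid.equality) (auto simp: restriction_def)

locale finite_matroid =
  fixes M :: "'a matroid"
  assumes finite_ground: "finite (ground M)"
    and indep_subset: "I \<in> indep M \<Longrightarrow> I \<subseteq> ground M"
    and empty_indep: "{} \<in> indep M"
    and indep_mono: "I \<in> indep M \<Longrightarrow> J \<subseteq> I \<Longrightarrow> J \<in> indep M"
    and augment: "I \<in> indep M \<Longrightarrow> J \<in> indep M \<Longrightarrow> card I < card J \<Longrightarrow>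
      \<exists>x \<in> J - I. insert x I \<in> indep M"
begin

abbreviation rank :: "'a set \<Rightarrow> nat" where
  "rank X \<equiv> rk (restriction M X)"

lemma finite_indep: "I \<in> indep M \<Longrightarrow> finite I"
  using indep_subset finite_ground finite_subset by blast

lemma finite_indeps: "finite (indep M)"
  by (rule finite_subset[of _ "Pow (ground M)"]) (use indep_subset finite_ground in auto)

lemma rank_eq_Max: "rank X = Max (card ` {I \<in> indep M. I \<subseteq> X})"
  by (simp add: rk_def restriction_def)

lemma card_le_rank: "I \<in> indep M \<Longrightarrow> I \<subseteq> X \<Longrightarrow> card I \<le> rank X"
  unfolding rank_eq_Max by (rule Max_ge) (use finite_indeps in auto)

lemma rank_attained:
  obtains I where "I \<in> indep M" "I \<subseteq> X" "card I = rank X"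
proof -
  have "rank X \<in> card ` {I \<in> indep M. I \<subseteq> X}"
    unfolding rank_eq_Max by (rule Max_in) (use finite_indeps empty_indep in auto)
  then show ?thesis using that by auto
qed

lemma rank_mono: "X \<subseteq> Y \<Longrightarrow> rank X \<le> rank Y"
  by (rule rank_attained[of X]) (metis card_le_rank order_trans)

lemma rank_ground: "rank (ground M) = rk M"
  using indep_subset by (simp add: restriction_ground subsetI)

lemma indep_extend:
  assumes "I \<in> indep M" "I \<subseteq> X"
  obtains J where "J \<in> indep M" "I \<subseteq> J" "J \<subseteq> X" "card J = rank X"
proof -
  have "finite {J \<in> indep M. J \<subseteq> X}" "I \<in> {J \<in> indep M. J \<subseteq> X}"
    using finite_indeps assms by auto
  then obtain J where J: "J \<in> indep M" "J \<subseteq> X" "I \<subseteq> J"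
    and maximal: "\<And>K. K \<in> indep M \<Longrightarrow> K \<subseteq> X \<Longrightarrow> J \<subseteq> K \<Longrightarrow> J = K"
    using finite_has_maximal2[of "{J \<in> indep M. J \<subseteq> X}" I] by auto
  have "\<not> card J < rank X"
  proof
    assume "card J < rank X"
    moreover obtain K where K: "K \<in> indep M" "K \<subseteq> X" "card K = rank X" by (rule rank_attained)
    ultimately obtain x where "x \<in> K - J" "insert x J \<in> indep M" using augment J by force
    then show False using maximal[of "insert x J"] J K by auto
  qed
  then show ?thesis using that[of J] J card_le_rank[of J X] by simp
qed

lemma bases_restriction: "bases (restriction M F) = {B \<in> indep M. B \<subseteq> F \<and> card B = rank F}"
proof (intro set_eqI iffI)
  fix B assume B: "B \<in> bases (restriction M F)"
  then have "B \<in> indep M" "B \<subseteq> F" by (auto simp: bases_def restriction_def)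
  then obtain J where J: "J \<in> indep M" "B \<subseteq> J" "J \<subseteq> F" "card J = rank F" by (rule indep_extend)
  with B have "J = B" by (simp add: bases_def restriction_def)
  with J show "B \<in> {B \<in> indep M. B \<subseteq> F \<and> card B = rank F}" by simp
next
  fix B assume B: "B \<in> {B \<in> indep M. B \<subseteq> F \<and> card B = rank F}"
  have "I = B" if "I \<in> indep M" "I \<subseteq> F" "B \<subseteq> I" for I
    using that B card_le_rank[OF that(1,2)] card_seteq[OF finite_indep[OF that(1)] that(3)] by simp
  with B show "B \<in> bases (restriction M F)" by (auto simp: bases_def restriction_def)
qed

lemma ground_contraction: "ground (contraction M F) = ground M - F"
  by (simp add: contraction_def)

lemma indep_contraction:
  "indep (contraction M F) = {I. I \<subseteq> ground M - F \<and>
     (\<exists>B \<in> indep M. B \<subseteq> F \<and> card B = rank F \<and> I \<union> B \<in> indep M)}"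
  by (auto simp: contraction_def bases_restriction)

lemma card_indep_contraction_le:
  assumes "I \<in> indep (contraction M F)" "I \<subseteq> X"
  shows "card I + rank F \<le> rank (X \<union> F)"
proof -
  from assms(1) obtain B where I: "I \<subseteq> ground M - F"
    and B: "B \<subseteq> F" "card B = rank F" "I \<union> B \<in> indep M"
    by (auto simp: indep_contraction)
  have "card (I \<union> B) \<le> rank (X \<union> F)"
    using B assms(2) by (intro card_le_rank) auto
  moreover have "card (I \<union> B) = card I + card B"
    using B I finite_indep[OF B(3)] by (intro card_Un_disjoint) auto
  ultimately show ?thesis using B by simp
qed

lemma contraction_basis:
  assumes "X \<subseteq> ground M - F"
  obtains I where "I \<in> indep (contraction M F)" "I \<subseteq> X" "card I + rank F = rank (X \<union> F)"
proof -
  obtain B where B: "B \<in> indep M" "B \<subseteq> F" "card B = rank F" by (rule rank_attained)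
  then have "B \<subseteq> X \<union> F" by auto
  with B(1) obtain J where J: "J \<in> indep M" "B \<subseteq> J" "J \<subseteq> X \<union> F" "card J = rank (X \<union> F)"
    by (rule indep_extend)
  have fin: "finite J" using J(1) by (rule finite_indep)
  have "J \<inter> F \<in> indep M" using J(1) indep_mono by blast
  then have "card (J \<inter> F) \<le> card B" using B card_le_rank by simp
  then have "B = J \<inter> F" using B J fin by (intro card_seteq) auto
  then have "J - B \<subseteq> X" "J - B \<union> B = J" using J by auto
  then have "J - B \<in> indep (contraction M F)"
    using assms B J(1) by (auto simp: indep_contraction intro!: bexI[of _ B])
  moreover have "card (J - B) + card B = card J"
    using fin J(2) by (metis card_Diff_subset card_mono finite_subset le_add_diff_inverse2)
  ultimately show ?thesis using that \<open>J - B \<subseteq> X\<close> B J by simp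
qed

lemma rank_contraction:
  assumes "X \<subseteq> ground M - F"
  shows "rk (restriction (contraction M F) X) + rank F = rank (X \<union> F)"
proof -
  obtain I where I: "I \<in> indep (contraction M F)" "I \<subseteq> X" "card I + rank F = rank (X \<union> F)"
    using assms by (rule contraction_basis)
  have "card J \<le> card I" if "J \<in> indep (contraction M F)" "J \<subseteq> X" for J
    using card_indep_contraction_le[OF that] I(3) by simp
  then show ?thesis using rk_restriction_eqI[OF I(1,2)] I(3) by simp
qed

lemma rk_contraction:
  assumes "F \<subseteq> ground M"
  shows "rk (contraction M F) + rank F = rk M"
proof -
  have "ground M - F \<union> F = ground M" using assms by auto
  moreover have "restriction (contraction M F) (ground M - F) = contraction M F"
    using restriction_ground[of "contraction M F"]
    by (auto simp: ground_contraction indep_contraction)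
  ultimately show ?thesis
    using rank_contraction[of "ground M - F" F] by (simp add: rank_ground)
qed

lemma flat_contraction_iff:
  assumes "F \<subseteq> ground M" "H \<subseteq> ground M - F"
  shows "H \<in> flats (contraction M F) \<longleftrightarrow> H \<union> F \<in> flats M"
proof -
  have "rk (restriction (contraction M F) H) < rk (restriction (contraction M F) (insert x H))
      \<longleftrightarrow> rank (H \<union> F) < rank (insert x (H \<union> F))" if "x \<in> ground M - F - H" for x
    using that assms rank_contraction[of H F] rank_contraction[of "insert x H" F] by auto
  moreover have "ground M - F - H = ground M - (H \<union> F)" by auto
  ultimately show ?thesis using assms unfolding flats_def ground_contraction by auto
qed

lemma flats_contraction:
  assumes "F \<subseteq> ground M"
  shows "flats (contraction M F) = (\<lambda>G. G - F) ` {G \<in> flats M. F \<subseteq> G}"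
proof (intro set_eqI iffI)
  fix H assume H: "H \<in> flats (contraction M F)"
  then have sub: "H \<subseteq> ground M - F" by (simp add: flats_def ground_contraction)
  then have "H = H \<union> F - F" by auto
  then show "H \<in> (\<lambda>G. G - F) ` {G \<in> flats M. F \<subseteq> G}"
    using H flat_contraction_iff[OF assms sub] by blast
next
  fix H assume "H \<in> (\<lambda>G. G - F) ` {G \<in> flats M. F \<subseteq> G}"
  then obtain G where G: "H = G - F" "G \<in> flats M" "F \<subseteq> G" by auto
  then have "H \<subseteq> ground M - F" "H \<union> F = G" by (auto simp: flats_def)
  then show "H \<in> flats (contraction M F)" using flat_contraction_iff[OF assms] G by simp
qed

lemma flat_subset: "F \<in> flats M \<Longrightarrow> F \<subseteq> ground M"
  by (simp add: flats_def)

lemma finite_flat: "F \<in> flats M \<Longrightarrow> finite F"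
  using flat_subset finite_ground by (rule finite_subset)

lemma finite_flats: "finite (flats M)"
  by (rule finite_subset[of _ "Pow (ground M)"]) (use flat_subset finite_ground in auto)

lemma ground_flat: "ground M \<in> flats M"
  by (simp add: flats_def)

end

section \<open>Reversed characteristic polynomials\<close>

lemma sum_moebius:
  assumes "finite Y" "X \<in> L" "Y \<in> L" "X \<subseteq> Y"
  shows "(\<Sum>Z | Z \<in> L \<and> X \<subseteq> Z \<and> Z \<subseteq> Y. moebius L X Z) = of_bool (X = Y)"
proof (cases "X = Y")
  case True
  then have "{Z. Z \<in> L \<and> X \<subseteq> Z \<and> Z \<subseteq> Y} = {Y}" using assms by auto
  then show ?thesis using True assms by (simp add: moebius.simps)
next
  case False
  have "{Z. Z \<in> L \<and> X \<subseteq> Z \<and> Z \<subseteq> Y} = insert Y {Z \<in> L. X \<subseteq> Z \<and> Z \<subset> Y}"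
    using assms by auto
  moreover have "finite {Z \<in> L. X \<subseteq> Z \<and> Z \<subset> Y}"
    by (rule finite_subset[of _ "Pow Y"]) (use assms in auto)
  ultimately show ?thesis
    using False assms by (simp add: moebius.simps[of L X Y] psubset_eq)
qed

lemma moebius_image_above:
  assumes embed: "\<And>Z W. Z \<in> L \<Longrightarrow> W \<in> L \<Longrightarrow> X \<subseteq> Z \<Longrightarrow> X \<subseteq> W \<Longrightarrow> f Z \<subseteq> f W \<longleftrightarrow> Z \<subseteq> W"
    and fin: "\<And>Z. Z \<in> L \<Longrightarrow> finite (f Z)"
    and "X \<in> L" "Y \<in> L" "X \<subseteq> Y" "finite Y"
  shows "moebius (f ` {Z \<in> L. X \<subseteq> Z}) (f X) (f Y) = moebius L X Y"
  using \<open>finite Y\<close> \<open>Y \<in> L\<close> \<open>X \<subseteq> Y\<close>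
proof (induction Y rule: finite_psubset_induct)
  case (psubset Y)
  let ?L = "f ` {Z \<in> L. X \<subseteq> Z}" and ?I = "{Z \<in> L. X \<subseteq> Z \<and> Z \<subset> Y}"
  have strict: "f Z \<subset> f W \<longleftrightarrow> Z \<subset> W" if "Z \<in> L" "W \<in> L" "X \<subseteq> Z" "X \<subseteq> W" for Z W
    using that by (simp add: less_le_not_le embed)
  show ?case
  proof (cases "X = Y")
    case True
    then show ?thesis using \<open>X \<in> L\<close> by (simp add: moebius.simps)
  next
    case False
    then have "X \<subset> Y" "f X \<subset> f Y" using psubset.prems \<open>X \<in> L\<close> strict[of X Y] by auto
    have "{W \<in> ?L. f X \<subseteq> W \<and> W \<subset> f Y} = f ` {Z. (Z \<in> L \<and> X \<subseteq> Z) \<and> f X \<subseteq> f Z \<and> f Z \<subset> f Y}"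
      by blast
    also have "\<dots> = f ` ?I"
      using psubset.prems \<open>X \<in> L\<close>
      by (intro arg_cong[where f = "image f"] Collect_cong) (metis embed strict order_refl)
    moreover have "inj_on f ?I"
      by (rule inj_onI) (metis (no_types, lifting) embed mem_Collect_eq order_refl subset_antisym)
    ultimately have "(\<Sum>Z | Z \<in> ?L \<and> f X \<subseteq> Z \<and> Z \<subset> f Y. moebius ?L (f X) Z) =
        (\<Sum>Z\<in>?I. moebius ?L (f X) (f Z))"
      by (simp add: sum.reindex)
    also have "\<dots> = (\<Sum>Z\<in>?I. moebius L X Z)"
      using psubset.IH by (intro sum.cong) auto
    finally show ?thesis
      using \<open>X \<subset> Y\<close> \<open>f X \<subset> f Y\<close> psubset fin
      by (simp add: moebius.simps[of ?L "f X" "f Y"] moebius.simps[of L X Y] less_imp_neq)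
  qed
qed

definition rev_char_poly :: "'a matroid \<Rightarrow> int poly" where
  "rev_char_poly M = reversal (rk M) (char_poly M)"

lemma rev_char_poly_altdef:
  assumes "\<And>F. F \<in> flats M \<Longrightarrow> rk (restriction M F) \<le> rk M"
  shows "rev_char_poly M = (\<Sum>F \<in> flats M. monom (moebius (flats M) {} F) (rk (restriction M F)))"
proof -
  have "degree (monom c (rk M - d)) \<le> rk M" for c :: int and d
    using degree_monom_le diff_le_self by (rule order_trans)
  then show ?thesis
    using assms by (simp add: rev_char_poly_def char_poly_def reversal_sum reversal_monom)
qed

context finite_matroid
begin

lemma rev_char_poly_contraction:
  assumes F: "F \<in> flats M"
  shows "rev_char_poly (contraction M F) =
    (\<Sum>G | G \<in> flats M \<and> F \<subseteq> G. monom (moebius (flats M) F G) (rank G - rank F))"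
proof -
  let ?C = "contraction M F" and ?\<G> = "{G \<in> flats M. F \<subseteq> G}"
  have flats_C: "flats ?C = (\<lambda>G. G - F) ` ?\<G>"
    using F by (intro flats_contraction flat_subset)
  have rank_C: "rk (restriction ?C (G - F)) = rank G - rank F" if "G \<in> ?\<G>" for G
  proof -
    have "G - F \<union> F = G" "G - F \<subseteq> ground M - F" using that flat_subset by auto
    then show ?thesis using rank_contraction[of "G - F" F] by simp
  qed
  have rank_C_le: "rk (restriction ?C H) \<le> rk ?C" if "H \<in> flats ?C" for H
  proof -
    from \<open>H \<in> flats ?C\<close> obtain G where G: "G \<in> ?\<G>" "H = G - F"
      unfolding flats_C by (rule imageE)
    then have "rank G \<le> rk M" using rank_mono[OF flat_subset[of G]] by (simp add: rank_ground)
    then show ?thesis using G rank_C[of G] rk_contraction[OF flat_subset[OF F]] by simp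
  qed
  have moebius_C: "moebius (flats ?C) {} (G - F) = moebius (flats M) F G" if "G \<in> ?\<G>" for G
    using moebius_image_above[of "flats M" F "\<lambda>G. G - F" G] that F finite_flat
    unfolding flats_C by auto
  have "inj_on (\<lambda>G. G - F) ?\<G>" by (auto simp: inj_on_def)
  then have "rev_char_poly ?C =
      (\<Sum>G\<in>?\<G>. monom (moebius (flats ?C) {} (G - F)) (rk (restriction ?C (G - F))))"
    using rev_char_poly_altdef[OF rank_C_le] by (simp add: flats_C sum.reindex)
  then show ?thesis by (simp add: moebius_C rank_C)
qed

text \<open>Moebius inversion on the interval above \<open>F\<close>.\<close>

lemma rev_char_poly_contraction_eqI:
  assumes F: "F \<in> flats M"
    and p: "\<And>G. G \<in> flats M \<Longrightarrow> F \<subseteq> G \<Longrightarrow>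
      (\<Sum>H | H \<in> flats M \<and> G \<subseteq> H. [:0, 1:] ^ (rank H - rank G) * p H) = 1"
  shows "rev_char_poly (contraction M F) = p F"
proof -
  let ?\<G> = "{G \<in> flats M. F \<subseteq> G}" and ?\<mu> = "\<lambda>G. moebius (flats M) F G"
  let ?q = "\<lambda>H. [:0, 1:] ^ (rank H - rank F) * p H"
  have "rev_char_poly (contraction M F) = (\<Sum>G\<in>?\<G>. monom (?\<mu> G) (rank G - rank F) *
      (\<Sum>H | H \<in> flats M \<and> G \<subseteq> H. [:0, 1:] ^ (rank H - rank G) * p H))"
    unfolding rev_char_poly_contraction[OF F] by (intro sum.cong) (simp_all add: p)
  also have "\<dots> = (\<Sum>G\<in>?\<G>. \<Sum>H | H \<in> ?\<G> \<and> G \<subseteq> H. smult (?\<mu> G) (?q H))"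
    unfolding sum_distrib_left
  proof (intro sum.cong refl)
    fix G H assume "G \<in> ?\<G>" "H \<in> {H. H \<in> ?\<G> \<and> G \<subseteq> H}"
    then have "(rank G - rank F) + (rank H - rank G) = rank H - rank F"
      using rank_mono[of F G] rank_mono[of G H] by simp
    then show "monom (?\<mu> G) (rank G - rank F) * ([:0, 1:] ^ (rank H - rank G) * p H) =
        smult (?\<mu> G) (?q H)"
      by (simp add: monom_altdef mult.assoc[symmetric] flip: power_add)
  qed auto
  also have "\<dots> = (\<Sum>H\<in>?\<G>. \<Sum>G | G \<in> ?\<G> \<and> G \<subseteq> H. smult (?\<mu> G) (?q H))"
    using finite_flats by (intro sum.swap_restrict) simp_all
  also have "\<dots> = (\<Sum>H\<in>?\<G>. smult (of_bool (F = H)) (?q H))"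
  proof (rule sum.cong[OF refl])
    fix H assume H: "H \<in> ?\<G>"
    have "{G. G \<in> ?\<G> \<and> G \<subseteq> H} = {G. G \<in> flats M \<and> F \<subseteq> G \<and> G \<subseteq> H}" by auto
    then show "(\<Sum>G | G \<in> ?\<G> \<and> G \<subseteq> H. smult (?\<mu> G) (?q H)) = smult (of_bool (F = H)) (?q H)"
      using H F finite_flat[of H] sum_moebius[of H F "flats M"] by (simp flip: smult_sum)
  qed
  also have "\<dots> = (\<Sum>H\<in>{F}. ?q H)"
    using finite_flats F by (intro sum.mono_neutral_cong_right) auto
  finally show ?thesis by simp
qed

lemma rev_char_poly_contraction_ground: "rev_char_poly (contraction M (ground M)) = 1"
proof (rule rev_char_poly_contraction_eqI[where p = "\<lambda>_. 1"])
  fix G assume "G \<in> flats M" "ground M \<subseteq> G"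
  then have "G = ground M" "{H. H \<in> flats M \<and> G \<subseteq> H} = {ground M}"
    using flat_subset ground_flat by auto
  then show "(\<Sum>H | H \<in> flats M \<and> G \<subseteq> H. [:0, 1:] ^ (rank H - rank G) * 1) = (1 :: int poly)"
    by simp
qed (rule ground_flat)

lemma inverse_KL_eqI:
  assumes deg: "2 * degree (Q (ground M)) < rk M"
    and Q: "\<And>F. F \<in> flats M \<Longrightarrow> F \<noteq> ground M \<Longrightarrow> inverse_KL (restriction M F) = Q F"
    and eq: "(-1) ^ rk M * reversal (rk M) (Q (ground M)) =
      (\<Sum>F \<in> flats M. (-1) ^ rank F * Q F * rev_char_poly (contraction M F))"
  shows "inverse_KL M = Q (ground M)"
proof -
  define rest where "rest =
    (\<Sum>F \<in> flats M - {ground M}. (-1) ^ rank F * Q F * rev_char_poly (contraction M F))"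
  have split: "(\<Sum>F \<in> flats M. (-1) ^ rank F * g F * rev_char_poly (contraction M F)) =
      (-1) ^ rk M * g (ground M) + rest"
    if "\<And>F. F \<in> flats M \<Longrightarrow> F \<noteq> ground M \<Longrightarrow> g F = Q F" for g
    unfolding rest_def sum.remove[OF finite_flats ground_flat]
    using that by (simp add: rev_char_poly_contraction_ground rank_ground)
  have solution: "(-1) ^ rk M * reversal (rk M) (Q (ground M)) = (-1) ^ rk M * Q (ground M) + rest"
    using eq split[of Q] by simp
  have sum_unknown: "(\<Sum>F \<in> flats M. (-1) ^ rank F *
      (if F = ground M then q else inverse_KL (restriction M F)) *
      rev_char_poly (contraction M F)) = (-1) ^ rk M * q + rest" for q
    using split[of "\<lambda>F. if F = ground M then q else inverse_KL (restriction M F)"] Q by simp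
  have unique: "q = Q (ground M)"
    if q: "2 * degree q < rk M" "(-1) ^ rk M * reversal (rk M) q = (-1) ^ rk M * q + rest" for q
  proof (rule reversal_diff_unique[OF q(1) deg])
    have "(-1) ^ rk M * (reversal (rk M) q - q) =
        (-1) ^ rk M * (reversal (rk M) (Q (ground M)) - Q (ground M))"
      unfolding right_diff_distrib q(2) solution by simp
    then show "reversal (rk M) q - q = reversal (rk M) (Q (ground M)) - Q (ground M)"
      by simp
  qed
  have "(THE q. 2 * degree q < rk M \<and>
      (-1) ^ rk M * reversal (rk M) q = (-1) ^ rk M * q + rest) = Q (ground M)"
    by (rule the_equality, rule conjI[OF deg solution], elim conjE, rule unique)
  moreover have "rk M \<noteq> 0" using deg by simp
  ultimately show ?thesis
    using finite_ground by (subst inverse_KL.simps)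
      (simp only: sum_unknown if_False not_not simp_thms flip: rev_char_poly_def)
qed

end

section \<open>Boolean matroids\<close>

definition boolean_matroid :: "'a set \<Rightarrow> 'a matroid" where
  "boolean_matroid E = \<lparr>ground = E, indep = Pow E\<rparr>"

lemma ground_boolean: "ground (boolean_matroid E) = E"
  by (simp add: boolean_matroid_def)

lemma finite_matroid_boolean:
  assumes fin: "finite E"
  shows "finite_matroid (boolean_matroid E)"
proof
  fix I J assume "I \<in> indep (boolean_matroid E)" "J \<in> indep (boolean_matroid E)" "card I < card J"
  then have "I \<subseteq> E" "J \<subseteq> E" "\<not> J \<subseteq> I"
    using fin by (auto simp: boolean_matroid_def dest: card_mono[OF finite_subset[OF _ fin]])
  then show "\<exists>x\<in>J - I. insert x I \<in> indep (boolean_matroid E)"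
    by (auto simp: boolean_matroid_def)
qed (use fin in \<open>auto simp: boolean_matroid_def\<close>)

lemma restriction_boolean: "X \<subseteq> E \<Longrightarrow> restriction (boolean_matroid E) X = boolean_matroid X"
  by (auto simp: restriction_def boolean_matroid_def)

lemma rk_boolean:
  assumes "finite E"
  shows "rk (boolean_matroid E) = card E"
  unfolding rk_def boolean_matroid_def
  by (simp, intro Max_eqI) (use assms in \<open>auto intro: card_mono\<close>)

lemma rank_boolean:
  assumes "finite E" "X \<subseteq> E"
  shows "rk (restriction (boolean_matroid E) X) = card X"
  using assms finite_subset[OF assms(2,1)] by (simp add: restriction_boolean rk_boolean)

lemma flats_boolean:
  assumes "finite E"
  shows "flats (boolean_matroid E) = Pow E"
  using assms finite_subset[OF _ assms]
  by (auto simp: flats_def ground_boolean rank_boolean)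

lemma rev_char_poly_contraction_boolean:
  assumes fin: "finite E" and "F \<subseteq> E"
  shows "rev_char_poly (contraction (boolean_matroid E) F) = [:1, -1:] ^ card (E - F)"
proof -
  interpret finite_matroid "boolean_matroid E"
    using fin by (rule finite_matroid_boolean)
  show ?thesis
  proof (rule rev_char_poly_contraction_eqI[where p = "\<lambda>H. [:1, -1:] ^ card (E - H)"])
    fix G assume "G \<in> flats (boolean_matroid E)"
    then have G: "G \<subseteq> E" "finite G" using fin finite_subset by (auto simp: flats_boolean)
    have "(\<Sum>H | H \<in> flats (boolean_matroid E) \<and> G \<subseteq> H.
          [:0, 1:] ^ (rank H - rank G) * [:1, -1:] ^ card (E - H)) =
        (\<Sum>H\<in>{G..E}. [:0, 1:] ^ card (H - G) * [:1, -1::int:] ^ card (E - H))"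
      using fin G by (intro sum.cong) (auto simp: flats_boolean rank_boolean card_Diff_subset)
    then show "(\<Sum>H | H \<in> flats (boolean_matroid E) \<and> G \<subseteq> H.
        [:0, 1:] ^ (rank H - rank G) * [:1, -1:] ^ card (E - H)) = (1 :: int poly)"
      using sum_set_interval_power_X_one_minus_X[OF fin G(1)] by simp
  qed (use assms in \<open>simp add: flats_boolean\<close>)
qed

lemma inverse_KL_boolean:
  assumes "finite E"
  shows "inverse_KL (boolean_matroid E) = 1"
  using assms
proof (induction E rule: finite_psubset_induct)
  case (psubset E)
  note fin = psubset.hyps
  interpret finite_matroid "boolean_matroid E"
    using fin by (rule finite_matroid_boolean)
  show ?case
  proof (cases "E = {}")
    case True
    then show ?thesis by (subst inverse_KL.simps) (simp add: ground_boolean rk_boolean)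
  next
    case False
    have "(\<Sum>F \<in> flats (boolean_matroid E).
          (-1) ^ rank F * 1 * rev_char_poly (contraction (boolean_matroid E) F)) =
        (\<Sum>F\<in>Pow E. (-1) ^ card F * [:1, -1:] ^ card (E - F))"
      using fin
      by (intro sum.cong) (auto simp: flats_boolean rank_boolean rev_char_poly_contraction_boolean)
    also have "\<dots> = (-1 + [:1, -1:]) ^ card E"
      using fin by (rule sum_Pow_power)
    also have "\<dots> = (-1 * [:0, 1:]) ^ card E" by (simp add: one_pCons)
    also have "\<dots> = (-1) ^ card E * reversal (card E) 1"
      unfolding power_mult_distrib by (simp add: reversal_1 monom_altdef)
    finally show ?thesis
      using False fin psubset.IH
      by (intro inverse_KL_eqI[where Q = "\<lambda>_. 1"])
        (auto simp: flats_boolean ground_boolean rk_boolean restriction_boolean card_gt_0_iff)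
  qed
qed

section \<open>Edge sets of the thagomizer graph\<close>

definition thag_edges :: "bool \<Rightarrow> nat set \<Rightarrow> nat set \<Rightarrow> thag_vertex set set" where
  "thag_edges ab P Q =
     {e. ab \<and> e = {A, B}} \<union> (\<lambda>j. {A, Spike j}) ` P \<union> (\<lambda>j. {B, Spike j}) ` Q"

lemma thagomizer_graph_eq_thag_edges: "thagomizer_graph n = thag_edges True {1..n} {1..n}"
  by (auto simp: thagomizer_graph_def thag_edges_def)

lemma edge_in_thag_edges [simp]:
  "{A, B} \<in> thag_edges ab P Q \<longleftrightarrow> ab"
  "{A, Spike j} \<in> thag_edges ab P Q \<longleftrightarrow> j \<in> P"
  "{B, Spike j} \<in> thag_edges ab P Q \<longleftrightarrow> j \<in> Q"
  by (simp_all add: thag_edges_def doubleton_eq_iff image_iff)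

lemma ball_thag_edges:
  "(\<forall>e\<in>thag_edges ab P Q. R e) \<longleftrightarrow>
     (ab \<longrightarrow> R {A, B}) \<and> (\<forall>j\<in>P. R {A, Spike j}) \<and> (\<forall>j\<in>Q. R {B, Spike j})"
  by (auto simp: thag_edges_def)

lemma insert_thag_edges:
  "insert {A, B} (thag_edges ab P Q) = thag_edges True P Q"
  "insert {A, Spike j} (thag_edges ab P Q) = thag_edges ab (insert j P) Q"
  "insert {B, Spike j} (thag_edges ab P Q) = thag_edges ab P (insert j Q)"
  by (auto simp: thag_edges_def)

lemma thag_edges_subset_iff:
  "thag_edges ab P Q \<subseteq> thag_edges ab' P' Q' \<longleftrightarrow> (ab \<longrightarrow> ab') \<and> P \<subseteq> P' \<and> Q \<subseteq> Q'"
  by (simp add: subset_eq ball_thag_edges)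

lemma thag_edges_eq_iff: "thag_edges ab P Q = thag_edges ab' P' Q' \<longleftrightarrow> ab = ab' \<and> P = P' \<and> Q = Q'"
  by (auto simp: set_eq_subset[of "thag_edges ab P Q"] thag_edges_subset_iff)

lemma subset_thag_edgesE:
  assumes "X \<subseteq> thag_edges ab P Q"
  obtains ab' P' Q' where "X = thag_edges ab' P' Q'" "ab' \<longrightarrow> ab" "P' \<subseteq> P" "Q' \<subseteq> Q"
proof -
  have "X = thag_edges ({A, B} \<in> X) {j. {A, Spike j} \<in> X} {j. {B, Spike j} \<in> X}"
    using assms unfolding thag_edges_def by blast
  with assms that show ?thesis by (metis thag_edges_subset_iff)
qed

lemma finite_thag_edges: "finite P \<Longrightarrow> finite Q \<Longrightarrow> finite (thag_edges ab P Q)"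
  by (simp add: thag_edges_def)

text \<open>The number of paths of length at most two from \<open>A\<close> to \<open>B\<close> in \<open>thag_edges ab P Q\<close>.\<close>

definition AB_paths :: "bool \<Rightarrow> nat set \<Rightarrow> nat set \<Rightarrow> nat" where
  "AB_paths ab P Q = of_bool ab + card (P \<inter> Q)"

lemma card_thag_edges:
  assumes "finite P" "finite Q"
  shows "card (thag_edges ab P Q) = card (P \<union> Q) + AB_paths ab P Q"
proof -
  let ?A = "\<lambda>j. {A, Spike j}" and ?B = "\<lambda>j. {B, Spike j}"
  have "inj_on ?A P" "inj_on ?B Q" by (auto simp: inj_on_def doubleton_eq_iff)
  moreover have "{e. ab \<and> e = {A, B}} \<inter> (?A ` P \<union> ?B ` Q) = {}" "?A ` P \<inter> ?B ` Q = {}"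
    by (force simp: doubleton_eq_iff)+
  moreover have "card {e. ab \<and> e = {A, B}} = of_bool ab" by (cases ab) auto
  ultimately have "card (thag_edges ab P Q) = of_bool ab + (card P + card Q)"
    using assms by (simp add: thag_edges_def card_Un_disjoint card_image Un_assoc)
  then show ?thesis using card_Un_Int[OF assms] by (simp add: AB_paths_def)
qed

lemma AB_paths_insert_le:
  assumes "finite P" "finite Q"
  shows "AB_paths True P Q \<le> Suc (AB_paths ab P Q)"
    and "AB_paths ab (insert j P) Q \<le> Suc (AB_paths ab P Q)"
    and "AB_paths ab P (insert j Q) \<le> Suc (AB_paths ab P Q)"
  using assms by (auto simp: AB_paths_def card_insert_if Int_insert_left Int_insert_right)

lemma spike_edge_iff:
  "{Spike j, v} \<in> thag_edges ab P Q \<longleftrightarrow> v = A \<and> j \<in> P \<or> v = B \<and> j \<in> Q"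
  by (simp add: thag_edges_def doubleton_eq_iff image_iff) blast

lemma cycle_edges_eq_image:
  "cycle_edges vs = (\<lambda>i. {vs ! i, vs ! (Suc i mod length vs)}) ` {..<length vs}"
  unfolding cycle_edges_def by blast

lemma cycle_edges_3: "cycle_edges [x, y, z] = {{x, y}, {y, z}, {z, x}}"
  unfolding cycle_edges_eq_image by (simp add: lessThan_Suc) (simp add: insert_commute)

lemma cycle_edges_4: "cycle_edges [x, y, z, w] = {{x, y}, {y, z}, {z, w}, {w, x}}"
  unfolding cycle_edges_eq_image by (simp add: lessThan_Suc) (simp add: insert_commute)

lemma cycle_neighbours:
  assumes "3 \<le> length vs" "distinct vs" "v \<in> set vs"
  obtains x y where "x \<noteq> y" "{v, x} \<in> cycle_edges vs" "{v, y} \<in> cycle_edges vs"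
proof -
  let ?n = "length vs"
  obtain i where i: "i < ?n" "vs ! i = v" using assms(3) by (auto simp: in_set_conv_nth)
  define next_i where "next_i = Suc i mod ?n"
  define prev_i where "prev_i = (if i = 0 then ?n - 1 else i - 1)"
  have prev: "prev_i < ?n" "Suc prev_i mod ?n = i"
    using i assms(1) by (auto simp: prev_i_def)
  have "next_i < ?n" "next_i \<noteq> prev_i"
    using i assms(1) by (auto simp: next_i_def prev_i_def mod_Suc split: if_splits)
  then have "vs ! next_i \<noteq> vs ! prev_i" using prev(1) assms(2) by (simp add: nth_eq_iff_index_eq)
  moreover have "{vs ! i, vs ! next_i} \<in> cycle_edges vs" "{vs ! prev_i, vs ! i} \<in> cycle_edges vs"
    using i(1) prev unfolding cycle_edges_def next_i_def by blast+
  ultimately show ?thesis using that i(2) by (metis insert_commute)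
qed

lemma spike_in_cycle:
  assumes "3 \<le> length vs" "distinct vs" "cycle_edges vs \<subseteq> thag_edges ab P Q" "Spike j \<in> set vs"
  shows "j \<in> P \<inter> Q"
proof -
  obtain x y where "x \<noteq> y" "{Spike j, x} \<in> cycle_edges vs" "{Spike j, y} \<in> cycle_edges vs"
    using assms(1,2,4) by (rule cycle_neighbours)
  then have "x \<noteq> y" "{Spike j, x} \<in> thag_edges ab P Q" "{Spike j, y} \<in> thag_edges ab P Q"
    using assms(3) by auto
  then show ?thesis unfolding spike_edge_iff by auto
qed

lemma AB_paths_le_1_if_forest:
  assumes "finite P" "finite Q" and forest: "forest (thag_edges ab P Q)"
  shows "AB_paths ab P Q \<le> 1"
proof -
  have acyclic: "\<not> cycle_edges vs \<subseteq> thag_edges ab P Q" if "3 \<le> length vs" "distinct vs" for vs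
    using forest that unfolding forest_def by blast
  have "\<not> (ab \<and> j \<in> P \<inter> Q)" for j
    using acyclic[of "[A, B, Spike j]"] by (simp add: cycle_edges_3 insert_commute)
  then have "P \<inter> Q = {}" if ab using that by blast
  moreover have "j = k" if "j \<in> P \<inter> Q" "k \<in> P \<inter> Q" for j k
    using acyclic[of "[A, Spike j, B, Spike k]"] that
    by (auto simp: cycle_edges_4 insert_commute)
  then have "card (P \<inter> Q) \<le> 1" using assms by (auto simp: card_le_Suc0_iff_eq)
  ultimately show ?thesis by (simp add: AB_paths_def)
qed

text \<open>A cycle consists of \<open>A\<close>, \<open>B\<close> and spikes in \<open>P \<inter> Q\<close>; if there is only one such spike, then the
  cycle is a triangle and contains the edge \<open>AB\<close>.\<close>

lemma forest_if_AB_paths_le_1: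
  assumes fin: "finite P" "finite Q" and le: "AB_paths ab P Q \<le> 1"
  shows "forest (thag_edges ab P Q)"
  unfolding forest_def
proof clarify
  fix vs assume vs: "3 \<le> length vs" "distinct vs" "cycle_edges vs \<subseteq> thag_edges ab P Q"
  have sub: "set vs \<subseteq> {A, B} \<union> Spike ` (P \<inter> Q)"
  proof
    fix v assume "v \<in> set vs"
    then show "v \<in> {A, B} \<union> Spike ` (P \<inter> Q)" using spike_in_cycle[OF vs]
      by (cases v rule: thag_vertex.exhaust) auto
  qed
  have "length vs = card (set vs)" using vs(2) by (simp add: distinct_card)
  also have "\<dots> \<le> card ({A, B} \<union> Spike ` (P \<inter> Q))" using sub fin by (intro card_mono) auto
  also have "\<dots> = 2 + card (P \<inter> Q)"
    using fin by (subst card_Un_disjoint) (auto simp: card_image inj_on_def)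
  finally have "card (P \<inter> Q) = 1" "\<not> ab" "length vs = 3"
    using le vs(1) by (auto simp: AB_paths_def split: if_splits)
  then obtain j x y z where j: "P \<inter> Q = {j}" and xyz: "vs = [x, y, z]"
    by (auto simp: card_1_singleton_iff numeral_3_eq_3 length_Suc_conv)
  have "{A, B} \<in> cycle_edges vs"
    using sub vs(2) unfolding xyz j cycle_edges_3 by (auto simp: insert_commute)
  then show False using vs(3) \<open>\<not> ab\<close> by auto
qed

section \<open>The thagomizer matroid on a set of spikes\<close>

definition thagomizer_on :: "nat set \<Rightarrow> thag_vertex set matroid" where
  "thagomizer_on S = graphic_matroid (thag_edges True S S)"

lemma ground_thagomizer_on: "ground (thagomizer_on S) = thag_edges True S S"
  by (simp add: thagomizer_on_def graphic_matroid_def)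

lemma restriction_thagomizer_on:
  "T \<subseteq> S \<Longrightarrow> restriction (thagomizer_on S) (thag_edges True T T) = thagomizer_on T"
  using thag_edges_subset_iff[of True T T True S S]
  by (auto simp: thagomizer_on_def restriction_def graphic_matroid_def)

context
  fixes S :: "nat set"
  assumes finite_S: "finite S"
begin

lemma indep_thagomizer_on_iff:
  "thag_edges ab P Q \<in> indep (thagomizer_on S) \<longleftrightarrow> P \<subseteq> S \<and> Q \<subseteq> S \<and> AB_paths ab P Q \<le> 1"
  using AB_paths_le_1_if_forest forest_if_AB_paths_le_1 finite_subset[OF _ finite_S]
  by (auto simp: thagomizer_on_def graphic_matroid_def thag_edges_subset_iff)

lemma indep_thagomizer_onE:
  assumes "X \<in> indep (thagomizer_on S)"
  obtains ab P Q where "X = thag_edges ab P Q" "P \<subseteq> S" "Q \<subseteq> S" "AB_paths ab P Q \<le> 1"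
proof -
  have "X \<subseteq> thag_edges True S S"
    using assms by (simp add: thagomizer_on_def graphic_matroid_def)
  then obtain ab P Q where "X = thag_edges ab P Q" by (rule subset_thag_edgesE)
  with assms show ?thesis using that indep_thagomizer_on_iff by blast
qed

lemma augment_thagomizer_on:
  assumes "I \<in> indep (thagomizer_on S)" "J \<in> indep (thagomizer_on S)" "card I < card J"
  shows "\<exists>x\<in>J - I. insert x I \<in> indep (thagomizer_on S)"
proof -
  from assms(1) obtain ab P Q where I: "I = thag_edges ab P Q" "P \<subseteq> S" "Q \<subseteq> S" "AB_paths ab P Q \<le> 1"
    by (rule indep_thagomizer_onE)
  from assms(2) obtain ab' P' Q'
    where J: "J = thag_edges ab' P' Q'" "P' \<subseteq> S" "Q' \<subseteq> S" "AB_paths ab' P' Q' \<le> 1"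
    by (rule indep_thagomizer_onE)
  have fin: "finite P" "finite Q" "finite P'" "finite Q'"
    using I J finite_subset[OF _ finite_S] by auto
  have card_less: "card (P \<union> Q) + AB_paths ab P Q < card (P' \<union> Q') + AB_paths ab' P' Q'"
    using assms(3) fin by (simp add: I(1) J(1) card_thag_edges)
  show ?thesis
  proof (cases "P' \<union> Q' \<subseteq> P \<union> Q")
    case False
    then obtain j where "j \<in> P' \<union> Q'" "j \<notin> P \<union> Q" by auto
    then consider "{A, Spike j} \<in> J - I" "insert {A, Spike j} I \<in> indep (thagomizer_on S)"
      | "{B, Spike j} \<in> J - I" "insert {B, Spike j} I \<in> indep (thagomizer_on S)"
      using I J by (auto simp: insert_thag_edges indep_thagomizer_on_iff AB_paths_def)
    then show ?thesis by cases blast+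
  next
    case True
    then have "card (P' \<union> Q') \<le> card (P \<union> Q)" using fin by (intro card_mono) auto
    with card_less J(4) have "AB_paths ab P Q = 0" by linarith
    then have "\<forall>x\<in>J. insert x I \<in> indep (thagomizer_on S)"
      using I(2,3) J(2,3) AB_paths_insert_le[OF fin(1,2), where ab = ab]
      unfolding I(1) J(1) ball_thag_edges insert_thag_edges indep_thagomizer_on_iff
      by auto
    moreover have "\<not> J \<subseteq> I"
      using assms(3) card_mono[of I J] fin by (auto simp: I(1) finite_thag_edges)
    ultimately show ?thesis by blast
  qed
qed

lemma finite_matroid_thagomizer_on: "finite_matroid (thagomizer_on S)"
proof
  show "finite (ground (thagomizer_on S))"
    using finite_S by (simp add: ground_thagomizer_on finite_thag_edges)
  show "I \<subseteq> ground (thagomizer_on S)" if "I \<in> indep (thagomizer_on S)" for I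
    using that by (simp add: thagomizer_on_def graphic_matroid_def)
  show "{} \<in> indep (thagomizer_on S)"
    using indep_thagomizer_on_iff[of False "{}" "{}"] by (simp add: thag_edges_def AB_paths_def)
  show "J \<in> indep (thagomizer_on S)" if "I \<in> indep (thagomizer_on S)" "J \<subseteq> I" for I J
    using that unfolding thagomizer_on_def graphic_matroid_def forest_def
    by simp (meson order_trans)
qed (rule augment_thagomizer_on)

interpretation finite_matroid "thagomizer_on S"
  by (rule finite_matroid_thagomizer_on)

lemma card_indep_thagomizer_on_le:
  assumes "J \<in> indep (thagomizer_on S)" "J \<subseteq> thag_edges ab P Q" "finite P" "finite Q"
  shows "card J \<le> card (P \<union> Q) + of_bool (ab \<or> P \<inter> Q \<noteq> {})"
proof -
  obtain ab' U V where J: "J = thag_edges ab' U V" "AB_paths ab' U V \<le> 1"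
    and sub: "ab' \<longrightarrow> ab" "U \<subseteq> P" "V \<subseteq> Q"
    using assms(1,2) by (metis indep_thagomizer_onE thag_edges_subset_iff)
  have fin: "finite U" "finite V" using sub assms(3,4) finite_subset by auto
  have "card (U \<union> V) \<le> card (P \<union> Q)" using sub assms(3,4) by (intro card_mono) auto
  moreover have "AB_paths ab' U V \<le> of_bool (ab \<or> P \<inter> Q \<noteq> {})"
  proof (cases "ab \<or> P \<inter> Q \<noteq> {}")
    case False
    then have "\<not> ab'" "U \<inter> V = {}" using sub by auto
    then show ?thesis by (simp add: AB_paths_def)
  qed (use J(2) in simp)
  ultimately show ?thesis
    unfolding J(1) card_thag_edges[OF fin] by (rule add_mono)
qed

text \<open>A basis takes one edge at each spike of \<open>P \<union> Q\<close>, and one more edge if there is a path from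
  \<open>A\<close> to \<open>B\<close>: the edge \<open>AB\<close> or the second edge at a spike in \<open>W \<subseteq> P \<inter> Q\<close>.\<close>

lemma rank_thag_edges:
  assumes "P \<subseteq> S" "Q \<subseteq> S"
  shows "rank (thag_edges ab P Q) = card (P \<union> Q) + of_bool (ab \<or> P \<inter> Q \<noteq> {})"
proof -
  have fin: "finite P" "finite Q" using assms finite_subset[OF _ finite_S] by auto
  obtain W where W: "W \<subseteq> P \<inter> Q"
    "of_bool ab + card W = (of_bool (ab \<or> P \<inter> Q \<noteq> {}) :: nat)"
  proof (cases "ab \<or> P \<inter> Q = {}")
    case True
    then show ?thesis using that[of "{}"] by auto
  next
    case False
    then obtain j where "j \<in> P \<inter> Q" by blast
    then show ?thesis using that[of "{j}"] False by auto
  qed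
  let ?I = "thag_edges ab P (Q - P \<union> W)"
  have "P \<inter> (Q - P \<union> W) = W" "P \<union> (Q - P \<union> W) = P \<union> Q" using W(1) by auto
  then have paths: "AB_paths ab P (Q - P \<union> W) = of_bool (ab \<or> P \<inter> Q \<noteq> {})"
    and card: "card ?I = card (P \<union> Q) + of_bool (ab \<or> P \<inter> Q \<noteq> {})"
    using W fin finite_subset[OF W(1)] by (simp_all add: AB_paths_def card_thag_edges)
  have "?I \<in> indep (thagomizer_on S)" "?I \<subseteq> thag_edges ab P Q"
    using assms W(1) by (auto simp: indep_thagomizer_on_iff paths thag_edges_subset_iff)
  then have "rank (thag_edges ab P Q) = card ?I"
    by (rule rk_restriction_eqI) (simp only: card card_indep_thagomizer_on_le fin)
  then show ?thesis by (simp only: card)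
qed

lemma rk_thagomizer_on: "rk (thagomizer_on S) = Suc (card S)"
  using rank_thag_edges[of S S True] rank_ground by (simp add: ground_thagomizer_on)

lemma rank_thag_edges_True: "T \<subseteq> S \<Longrightarrow> rank (thag_edges True T T) = Suc (card T)"
  by (simp add: rank_thag_edges)

lemma rank_thag_edges_False:
  assumes "P \<subseteq> S" "Q \<subseteq> S" "P \<inter> Q = {}"
  shows "rank (thag_edges False P Q) = card P + card Q"
  using assms finite_subset[OF _ finite_S] by (simp add: rank_thag_edges card_Un_disjoint)

lemma restriction_thag_edges_False:
  assumes "P \<subseteq> S" "Q \<subseteq> S" "P \<inter> Q = {}"
  shows "restriction (thagomizer_on S) (thag_edges False P Q) =
    boolean_matroid (thag_edges False P Q)"
proof -
  have "X \<in> indep (thagomizer_on S)" if "X \<subseteq> thag_edges False P Q" for X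
  proof (rule indep_mono[OF _ that])
    show "thag_edges False P Q \<in> indep (thagomizer_on S)"
      using assms by (simp add: indep_thagomizer_on_iff AB_paths_def)
  qed
  then show ?thesis by (auto simp: restriction_def boolean_matroid_def)
qed

lemma thag_edges_flat_iff:
  assumes "P \<subseteq> S" "Q \<subseteq> S"
  shows "thag_edges ab P Q \<in> flats (thagomizer_on S) \<longleftrightarrow> (if ab then P = Q else P \<inter> Q = {})"
proof -
  let ?F = "thag_edges ab P Q"
  have fin: "finite (P \<union> Q)" using assms finite_subset[OF _ finite_S] by auto
  have "?F \<in> flats (thagomizer_on S) \<longleftrightarrow>
      (\<forall>x\<in>thag_edges True S S. x \<notin> ?F \<longrightarrow> rank ?F < rank (insert x ?F))"
    using assms by (auto simp: flats_def ground_thagomizer_on thag_edges_subset_iff)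
  also have "\<dots> \<longleftrightarrow> (\<not> ab \<longrightarrow> rank ?F < rank (thag_edges True P Q)) \<and>
      (\<forall>j\<in>S. j \<notin> P \<longrightarrow> rank ?F < rank (thag_edges ab (insert j P) Q)) \<and>
      (\<forall>j\<in>S. j \<notin> Q \<longrightarrow> rank ?F < rank (thag_edges ab P (insert j Q)))"
    by (simp add: ball_thag_edges insert_thag_edges)
  also have "\<dots> \<longleftrightarrow> (if ab then P = Q else P \<inter> Q = {})"
    by (cases ab) (use assms fin in \<open>auto simp: rank_thag_edges card_insert_if\<close>)
  finally show ?thesis .
qed

lemma flats_thagomizer_on_cases:
  assumes "F \<in> flats (thagomizer_on S)"
  obtains (with_AB) T where "F = thag_edges True T T" "T \<subseteq> S"
  | (without_AB) P Q where "F = thag_edges False P Q" "P \<subseteq> S" "Q \<subseteq> S" "P \<inter> Q = {}"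
proof -
  obtain ab P Q where "F = thag_edges ab P Q" "P \<subseteq> S" "Q \<subseteq> S"
    using flat_subset[OF assms] by (auto simp: ground_thagomizer_on elim: subset_thag_edgesE)
  with assms that show ?thesis
    by (cases ab) (auto simp: thag_edges_flat_iff)
qed

lemma flats_above_thag_edges_True:
  assumes "T \<subseteq> S"
  shows "{G \<in> flats (thagomizer_on S). thag_edges True T T \<subseteq> G} =
    (\<lambda>U. thag_edges True U U) ` {T..S}" (is "?L = ?R")
proof (intro set_eqI iffI)
  fix G assume G: "G \<in> ?L"
  then have "G \<in> flats (thagomizer_on S)" by simp
  then show "G \<in> ?R"
    using G by (cases rule: flats_thagomizer_on_cases) (auto simp: thag_edges_subset_iff)
next
  fix G assume "G \<in> ?R"
  then obtain U where "G = thag_edges True U U" "T \<subseteq> U" "U \<subseteq> S" by auto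
  then show "G \<in> ?L" by (simp add: thag_edges_subset_iff thag_edges_flat_iff)
qed

lemma flats_above_thag_edges_False:
  assumes "P \<subseteq> S" "Q \<subseteq> S" "P \<inter> Q = {}"
  shows "{G \<in> flats (thagomizer_on S). thag_edges False P Q \<subseteq> G} =
    (\<lambda>U. thag_edges True U U) ` {P \<union> Q..S} \<union>
    (\<lambda>(U, V). thag_edges False U V) ` (SIGMA U:{P..S - Q}. {Q..S - U})" (is "?L = ?R")
proof (intro set_eqI iffI)
  fix G assume G: "G \<in> ?L"
  then have "G \<in> flats (thagomizer_on S)" by simp
  then show "G \<in> ?R"
  proof (cases rule: flats_thagomizer_on_cases)
    case (with_AB U)
    with G show ?thesis by (auto simp: thag_edges_subset_iff)
  next
    case (without_AB U V)
    with G have "(U, V) \<in> (SIGMA U:{P..S - Q}. {Q..S - U})"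
      by (auto simp: thag_edges_subset_iff)
    with without_AB(1) show ?thesis by auto
  qed
next
  fix G assume "G \<in> ?R"
  then consider (with_AB) U where "G = thag_edges True U U" "P \<union> Q \<subseteq> U" "U \<subseteq> S"
    | (without_AB) U V where "G = thag_edges False U V" "P \<subseteq> U" "U \<subseteq> S - Q" "Q \<subseteq> V" "V \<subseteq> S - U"
    by auto
  then show "G \<in> ?L"
  proof cases
    case with_AB
    then show ?thesis by (simp add: thag_edges_subset_iff thag_edges_flat_iff)
  next
    case without_AB
    then have "U \<subseteq> S" "V \<subseteq> S" "U \<inter> V = {}" by auto
    with without_AB show ?thesis by (simp add: thag_edges_subset_iff thag_edges_flat_iff)
  qed
qed

lemma sum_flats_above_thag_edges_True:
  assumes "T \<subseteq> S"
  shows "(\<Sum>G | G \<in> flats (thagomizer_on S) \<and> thag_edges True T T \<subseteq> G. f G) =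
    (\<Sum>U\<in>{T..S}. f (thag_edges True U U))"
  unfolding flats_above_thag_edges_True[OF assms]
  by (simp add: sum.reindex inj_on_def thag_edges_eq_iff)

lemma sum_flats_above_thag_edges_False:
  assumes "P \<subseteq> S" "Q \<subseteq> S" "P \<inter> Q = {}"
  shows "(\<Sum>G | G \<in> flats (thagomizer_on S) \<and> thag_edges False P Q \<subseteq> G. f G) =
    (\<Sum>U\<in>{P \<union> Q..S}. f (thag_edges True U U)) +
    (\<Sum>U\<in>{P..S - Q}. \<Sum>V\<in>{Q..S - U}. f (thag_edges False U V))"
proof -
  let ?g = "\<lambda>U. thag_edges True U U" and ?h = "\<lambda>(U, V). thag_edges False U V"
  let ?I = "SIGMA U:{P..S - Q}. {Q..S - U}"
  have fin: "finite {P \<union> Q..S}" "finite {P..S - Q}" "finite {Q..S - U}" for U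
    using finite_S by (simp_all add: finite_set_interval)
  have "?g ` {P \<union> Q..S} \<inter> ?h ` ?I = {}" by (auto simp: thag_edges_eq_iff)
  moreover have "finite ?I" using fin by auto
  moreover have "inj_on ?g {P \<union> Q..S}" "inj_on ?h ?I"
    by (auto simp: inj_on_def thag_edges_eq_iff)
  ultimately show ?thesis
    unfolding flats_above_thag_edges_False[OF assms] using fin
    by (simp add: sum.union_disjoint sum.reindex sum.Sigma case_prod_unfold)
qed

lemma sum_flats_thagomizer_on:
  "(\<Sum>F\<in>flats (thagomizer_on S). f F) = (\<Sum>T\<in>Pow S. f (thag_edges True T T)) +
    (\<Sum>P\<in>Pow S. \<Sum>Q\<in>Pow (S - P). f (thag_edges False P Q))"
proof -
  have "thag_edges False {} {} = {}" by (simp add: thag_edges_def)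
  then show ?thesis
    using sum_flats_above_thag_edges_False[of "{}" "{}" f] by (simp add: set_interval_empty_eq_Pow)
qed

end

section \<open>Characteristic polynomials of contractions of the thagomizer matroid\<close>

definition spikes :: "thag_vertex set set \<Rightarrow> nat set" where
  "spikes F = {j. {A, Spike j} \<in> F \<or> {B, Spike j} \<in> F}"

lemma spikes_thag_edges [simp]: "spikes (thag_edges ab P Q) = P \<union> Q"
  by (auto simp: spikes_def)

definition thag_contraction_poly :: "nat set \<Rightarrow> thag_vertex set set \<Rightarrow> int poly" where
  "thag_contraction_poly S F =
     (if {A, B} \<in> F then [:1, -1:] ^ card (S - spikes F)
      else [:1, -1:] * [:1, -2:] ^ card (S - spikes F))"

lemma thag_contraction_poly_thag_edges:
  "thag_contraction_poly S (thag_edges True U U) = [:1, -1:] ^ card (S - U)"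
  "thag_contraction_poly S (thag_edges False U V) = [:1, -1:] * [:1, -2:] ^ card (S - (U \<union> V))"
  by (simp_all add: thag_contraction_poly_def)

context
  fixes S :: "nat set"
  assumes finite_S: "finite S"
begin

interpretation finite_matroid "thagomizer_on S"
  using finite_S by (rule finite_matroid_thagomizer_on)

lemma rank_diff_thag_edges:
  shows "T \<subseteq> U \<Longrightarrow> U \<subseteq> S \<Longrightarrow>
      rank (thag_edges True U U) - rank (thag_edges True T T) = card (U - T)"
    and "P \<union> Q \<subseteq> U \<Longrightarrow> U \<subseteq> S \<Longrightarrow> P \<inter> Q = {} \<Longrightarrow>
      rank (thag_edges True U U) - rank (thag_edges False P Q) = Suc (card (U - (P \<union> Q)))"
    and "P \<subseteq> U \<Longrightarrow> Q \<subseteq> V \<Longrightarrow> U \<subseteq> S \<Longrightarrow> V \<subseteq> S \<Longrightarrow> U \<inter> V = {} \<Longrightarrow>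
      rank (thag_edges False U V) - rank (thag_edges False P Q) = card (U - P) + card (V - Q)"
proof -
  have card_split: "card Y = card X + card (Y - X)" if "X \<subseteq> Y" "Y \<subseteq> S" for X Y
    using that finite_subset[OF _ finite_S]
    by (metis card_Diff_subset card_mono finite_subset le_add_diff_inverse)
  show "rank (thag_edges True U U) - rank (thag_edges True T T) = card (U - T)"
    if "T \<subseteq> U" "U \<subseteq> S"
    using that card_split[OF that] by (simp add: rank_thag_edges_True[OF finite_S])
  show "rank (thag_edges True U U) - rank (thag_edges False P Q) = Suc (card (U - (P \<union> Q)))"
    if "P \<union> Q \<subseteq> U" "U \<subseteq> S" "P \<inter> Q = {}"
  proof -
    have "P \<subseteq> S" "Q \<subseteq> S" using that by auto
    moreover from this have "card (P \<union> Q) = card P + card Q"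
      using that(3) finite_subset[OF _ finite_S] by (intro card_Un_disjoint) auto
    ultimately show ?thesis
      using that card_split[OF that(1,2)]
      by (simp add: rank_thag_edges_True[OF finite_S] rank_thag_edges_False[OF finite_S])
  qed
  show "rank (thag_edges False U V) - rank (thag_edges False P Q) = card (U - P) + card (V - Q)"
    if "P \<subseteq> U" "Q \<subseteq> V" "U \<subseteq> S" "V \<subseteq> S" "U \<inter> V = {}"
  proof -
    have "P \<subseteq> S" "Q \<subseteq> S" "P \<inter> Q = {}" using that by auto
    then show ?thesis
      using that card_split[of P U] card_split[of Q V]
      by (simp add: rank_thag_edges_False[OF finite_S])
  qed
qed

lemma sum_thag_contraction_poly_above_True:
  assumes "T \<subseteq> S"
  shows "(\<Sum>H | H \<in> flats (thagomizer_on S) \<and> thag_edges True T T \<subseteq> H.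
      [:0, 1:] ^ (rank H - rank (thag_edges True T T)) * thag_contraction_poly S H) = 1"
proof -
  have "(\<Sum>H | H \<in> flats (thagomizer_on S) \<and> thag_edges True T T \<subseteq> H.
      [:0, 1:] ^ (rank H - rank (thag_edges True T T)) * thag_contraction_poly S H) =
      (\<Sum>U\<in>{T..S}. [:0, 1:] ^ card (U - T) * [:1, -1:] ^ card (S - U))"
    unfolding sum_flats_above_thag_edges_True[OF finite_S assms]
    by (intro sum.cong refl) (simp add: rank_diff_thag_edges thag_contraction_poly_thag_edges)
  then show ?thesis using sum_set_interval_power_X_one_minus_X[OF finite_S assms] by simp
qed

lemma sum_thag_contraction_poly_above_False:
  assumes PQ: "P \<subseteq> S" "Q \<subseteq> S" "P \<inter> Q = {}"
  shows "(\<Sum>H | H \<in> flats (thagomizer_on S) \<and> thag_edges False P Q \<subseteq> H.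
      [:0, 1:] ^ (rank H - rank (thag_edges False P Q)) * thag_contraction_poly S H) = 1"
proof -
  let ?f = "\<lambda>H. [:0, 1:] ^ (rank H - rank (thag_edges False P Q)) * thag_contraction_poly S H"
  have "(\<Sum>U\<in>{P \<union> Q..S}. ?f (thag_edges True U U)) =
      (\<Sum>U\<in>{P \<union> Q..S}. [:0, 1:] * ([:0, 1:] ^ card (U - (P \<union> Q)) * [:1, -1:] ^ card (S - U)))"
    using PQ(3)
    by (intro sum.cong refl) (simp add: rank_diff_thag_edges thag_contraction_poly_thag_edges)
  then have with_AB: "(\<Sum>U\<in>{P \<union> Q..S}. ?f (thag_edges True U U)) = [:0, 1:]"
    using sum_set_interval_power_X_one_minus_X[OF finite_S Un_least[OF PQ(1,2)]]
    by (simp only: mult_1_right flip: sum_distrib_left)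
  have "(\<Sum>U\<in>{P..S - Q}. \<Sum>V\<in>{Q..S - U}. ?f (thag_edges False U V)) =
      (\<Sum>U\<in>{P..S - Q}. \<Sum>V\<in>{Q..S - U}. [:1, -1:] *
        ([:0, 1:] ^ card (U - P) * [:0, 1:] ^ card (V - Q) * [:1, -2:] ^ card (S - (U \<union> V))))"
  proof (intro sum.cong refl)
    fix U V assume "U \<in> {P..S - Q}" "V \<in> {Q..S - U}"
    then have "P \<subseteq> U" "Q \<subseteq> V" "U \<subseteq> S" "V \<subseteq> S" "U \<inter> V = {}" by auto
    then show "?f (thag_edges False U V) = [:1, -1:] *
        ([:0, 1:] ^ card (U - P) * [:0, 1:] ^ card (V - Q) * [:1, -2:] ^ card (S - (U \<union> V)))"
      by (simp only: rank_diff_thag_edges thag_contraction_poly_thag_edges power_add mult_ac)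
  qed
  also have "\<dots> = [:1, -1:] * ([:0, 1:] + [:0, 1:] + [:1, -2:]) ^ card (S - (P \<union> Q))"
    by (simp only: sum_disjoint_set_intervals_power[OF finite_S PQ] flip: sum_distrib_left)
  also have "[:0, 1:] + [:0, 1:] + [:1, -2::int:] = 1" by (simp add: one_pCons)
  finally show ?thesis
    unfolding sum_flats_above_thag_edges_False[OF finite_S PQ] with_AB
    by (simp only: power_one mult_1_right) (simp add: one_pCons)
qed

lemma rev_char_poly_contraction_thagomizer_on:
  assumes "F \<in> flats (thagomizer_on S)"
  shows "rev_char_poly (contraction (thagomizer_on S) F) = thag_contraction_poly S F"
  using assms
proof (rule rev_char_poly_contraction_eqI)
  fix G assume "G \<in> flats (thagomizer_on S)"
  with finite_S show "(\<Sum>H | H \<in> flats (thagomizer_on S) \<and> G \<subseteq> H.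
      [:0, 1:] ^ (rank H - rank G) * thag_contraction_poly S H) = 1"
    by (cases rule: flats_thagomizer_on_cases)
      (simp_all only: sum_thag_contraction_poly_above_True sum_thag_contraction_poly_above_False)
qed

end

section \<open>The inverse Kazhdan--Lusztig polynomial\<close>

definition thag_inverse_KL :: "nat \<Rightarrow> int poly" where
  "thag_inverse_KL n = (\<Sum>s\<le>n. of_nat (n choose s) * ballot_poly s)"

lemma sum_Pow_ballot_poly:
  "finite S \<Longrightarrow> (\<Sum>U\<in>Pow S. ballot_poly (card U)) = thag_inverse_KL (card S)"
  by (simp add: sum_Pow_card thag_inverse_KL_def)

lemma degree_thag_inverse_KL: "degree (thag_inverse_KL n) \<le> n div 2"
  unfolding thag_inverse_KL_def
proof (rule degree_sum_le)
  fix s assume "s \<in> {..n}"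
  then have "degree (ballot_poly s) \<le> n div 2"
    using degree_ballot_poly[of s] by (meson atMost_iff div_le_mono order_trans)
  then show "degree (of_nat (n choose s) * ballot_poly s) \<le> n div 2"
    using degree_mult_le[of "of_nat (n choose s)" "ballot_poly s"] by simp
qed simp

lemma reversal_thag_inverse_KL:
  assumes "finite S"
  shows "reversal (Suc (card S)) (thag_inverse_KL (card S)) =
    (\<Sum>U\<in>Pow S. [:0, 1:] ^ card (S - U) * ballot_poly (card U)) - [:1, -1:] * [:1, 2:] ^ card S"
proof -
  have "reversal (Suc (card S)) (thag_inverse_KL (card S)) =
      (\<Sum>U\<in>Pow S. reversal (Suc (card S)) (ballot_poly (card U)))"
    unfolding sum_Pow_ballot_poly[OF assms, symmetric]
  proof (rule reversal_sum)
    fix U assume "U \<in> Pow S"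
    then have "card U \<le> card S" using assms by (auto intro: card_mono)
    then show "degree (ballot_poly (card U)) \<le> Suc (card S)"
      using degree_ballot_poly[of "card U"] by simp
  qed
  also have "\<dots> = (\<Sum>U\<in>Pow S. [:0, 1:] ^ card (S - U) * ballot_poly (card U) -
      [:1, -1:] * ([:1, 1:] ^ card U * [:0, 1:] ^ card (S - U)))"
  proof (rule sum.cong[OF refl])
    fix U assume "U \<in> Pow S"
    then have "Suc (card S) = card (S - U) + Suc (card U)"
      using assms by (simp add: card_Diff_subset card_mono finite_subset)
    moreover have "degree (ballot_poly (card U)) \<le> Suc (card U)"
      using degree_ballot_poly[of "card U"] by simp
    ultimately have "reversal (Suc (card S)) (1 * ballot_poly (card U)) =
        [:0, 1:] ^ card (S - U) * reversal (Suc (card U)) (ballot_poly (card U))"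
      by (simp only: reversal_mult degree_1 le0 reversal_1 monom_altdef smult_1_left)
    then show "reversal (Suc (card S)) (ballot_poly (card U)) =
        [:0, 1:] ^ card (S - U) * ballot_poly (card U) -
        [:1, -1:] * ([:1, 1:] ^ card U * [:0, 1:] ^ card (S - U))"
      unfolding reversal_ballot_poly right_diff_distrib by (simp only: mult_ac mult_1_left)
  qed
  also have "\<dots> = (\<Sum>U\<in>Pow S. [:0, 1:] ^ card (S - U) * ballot_poly (card U)) -
      [:1, -1:] * ([:1, 1:] + [:0, 1:]) ^ card S"
    by (simp only: sum_subtractf sum_Pow_power[OF assms] flip: sum_distrib_left)
  also have "[:1, 1:] + [:0, 1::int:] = [:1, 2:]" by simp
  finally show ?thesis .
qed

lemma sum_with_AB_inverse_KL:
  assumes "finite S"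
  shows "(\<Sum>T\<in>Pow S. (-1) ^ Suc (card T) * thag_inverse_KL (card T) * [:1, -1:] ^ card (S - T)) =
    (-1) ^ Suc (card S) * (\<Sum>U\<in>Pow S. [:0, 1:] ^ card (S - U) * ballot_poly (card U))"
proof -
  have "(\<Sum>T\<in>Pow S. (-1) ^ Suc (card T) * thag_inverse_KL (card T) * [:1, -1:] ^ card (S - T)) =
      (\<Sum>T\<in>Pow S. - ((-1) ^ card T * [:1, -1:] ^ card (S - T) * (\<Sum>U\<in>Pow T. ballot_poly (card U))))"
    using finite_subset[OF _ assms] by (intro sum.cong refl) (simp add: sum_Pow_ballot_poly)
  also have "\<dots> =
      - (\<Sum>U\<in>Pow S. (-1) ^ card U * (-1 + [:1, -1:]) ^ card (S - U) * ballot_poly (card U))"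
    by (simp only: sum_negf sum_Pow_binomial_transform[OF assms])
  also have "-1 + [:1, -1:] = -1 * [:0, 1::int:]" by (simp add: one_pCons)
  also have "- (\<Sum>U\<in>Pow S. (-1) ^ card U * (-1 * [:0, 1:]) ^ card (S - U) * ballot_poly (card U)) =
      - (\<Sum>U\<in>Pow S. (-1) ^ card S * ([:0, 1:] ^ card (S - U) * ballot_poly (card U)))"
  proof (intro arg_cong[where f = uminus] sum.cong refl)
    fix U assume "U \<in> Pow S"
    then have "card S = card U + card (S - U)"
      using assms by (simp add: card_Diff_subset card_mono finite_subset)
    then show "(-1) ^ card U * (-1 * [:0, 1:]) ^ card (S - U) * ballot_poly (card U) =
        (-1) ^ card S * ([:0, 1:] ^ card (S - U) * ballot_poly (card U))"
      by (simp only: power_mult_distrib power_add mult.assoc)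
  qed
  finally show ?thesis by (simp only: power_Suc mult_minus_left mult_1_left flip: sum_distrib_left)
qed

lemma sum_without_AB_inverse_KL:
  assumes "finite S"
  shows "(\<Sum>P\<in>Pow S. \<Sum>Q\<in>Pow (S - P).
      (-1) ^ (card P + card Q) * ([:1, -1:] * [:1, -2:] ^ card (S - (P \<union> Q)))) =
    (-1) ^ card S * ([:1, -1:] * [:1, 2::int:] ^ card S)"
proof -
  have "(\<Sum>P\<in>Pow S. \<Sum>Q\<in>Pow (S - P).
      (-1) ^ (card P + card Q) * ([:1, -1:] * [:1, -2:] ^ card (S - (P \<union> Q)))) =
      [:1, -1:] * (\<Sum>P\<in>Pow S. \<Sum>Q\<in>Pow (S - P).
        (-1) ^ card P * (-1) ^ card Q * [:1, -2::int:] ^ card (S - (P \<union> Q)))"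
    unfolding sum_distrib_left by (simp only: power_add mult_ac)
  also have "\<dots> = [:1, -1:] * (-1 + -1 + [:1, -2::int:]) ^ card S"
    using sum_disjoint_set_intervals_power[OF assms, of "{}" "{}" "-1" "-1" "[:1, -2::int:]"]
    by (simp only: set_interval_empty_eq_Pow) simp
  also have "-1 + -1 + [:1, -2::int:] = -1 * [:1, 2:]" by (simp add: one_pCons)
  finally show ?thesis by (simp only: power_mult_distrib mult_ac)
qed

lemma thag_inverse_KL_equation:
  assumes "finite S"
  shows "(-1) ^ Suc (card S) * reversal (Suc (card S)) (thag_inverse_KL (card S)) =
    (\<Sum>T\<in>Pow S. (-1) ^ Suc (card T) * thag_inverse_KL (card T) * [:1, -1:] ^ card (S - T)) +
    (\<Sum>P\<in>Pow S. \<Sum>Q\<in>Pow (S - P).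
      (-1) ^ (card P + card Q) * ([:1, -1:] * [:1, -2:] ^ card (S - (P \<union> Q))))"
  unfolding reversal_thag_inverse_KL[OF assms] sum_with_AB_inverse_KL[OF assms]
    sum_without_AB_inverse_KL[OF assms]
  by (simp only: right_diff_distrib power_Suc mult_minus_left mult_1_left diff_minus_eq_add)

definition flat_inverse_KL :: "thag_vertex set set \<Rightarrow> int poly" where
  "flat_inverse_KL F = (if {A, B} \<in> F then thag_inverse_KL (card (spikes F)) else 1)"

lemma flat_inverse_KL_thag_edges:
  "flat_inverse_KL (thag_edges True T T) = thag_inverse_KL (card T)"
  "flat_inverse_KL (thag_edges False P Q) = 1"
  by (simp_all add: flat_inverse_KL_def)

lemma sum_flats_flat_inverse_KL:
  fixes S
  defines "M \<equiv> thagomizer_on S"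
  assumes S: "finite S"
  shows "(\<Sum>F\<in>flats M.
      (-1) ^ rk (restriction M F) * flat_inverse_KL F * rev_char_poly (contraction M F)) =
    (-1) ^ Suc (card S) * reversal (Suc (card S)) (thag_inverse_KL (card S))"
proof -
  let ?f = "\<lambda>F. (-1) ^ rk (restriction M F) * flat_inverse_KL F *
    rev_char_poly (contraction M F)"
  have "(\<Sum>F\<in>flats M. ?f F) = (\<Sum>T\<in>Pow S. ?f (thag_edges True T T)) +
      (\<Sum>P\<in>Pow S. \<Sum>Q\<in>Pow (S - P). ?f (thag_edges False P Q))"
    unfolding M_def using S by (rule sum_flats_thagomizer_on)
  also have "(\<Sum>T\<in>Pow S. ?f (thag_edges True T T)) =
      (\<Sum>T\<in>Pow S. (-1) ^ Suc (card T) * thag_inverse_KL (card T) * [:1, -1:] ^ card (S - T))"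
    using S by (intro sum.cong refl)
      (simp add: M_def flat_inverse_KL_thag_edges rev_char_poly_contraction_thagomizer_on
        thag_edges_flat_iff thag_contraction_poly_thag_edges rank_thag_edges_True)
  also have "(\<Sum>P\<in>Pow S. \<Sum>Q\<in>Pow (S - P). ?f (thag_edges False P Q)) =
      (\<Sum>P\<in>Pow S. \<Sum>Q\<in>Pow (S - P).
        (-1) ^ (card P + card Q) * ([:1, -1:] * [:1, -2:] ^ card (S - (P \<union> Q))))"
  proof (intro sum.cong refl)
    fix P Q assume "P \<in> Pow S" "Q \<in> Pow (S - P)"
    then have "P \<subseteq> S" "Q \<subseteq> S" "P \<inter> Q = {}" by auto
    then show "?f (thag_edges False P Q) =
        (-1) ^ (card P + card Q) * ([:1, -1:] * [:1, -2:] ^ card (S - (P \<union> Q)))"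
      using S by (simp add: M_def flat_inverse_KL_thag_edges rev_char_poly_contraction_thagomizer_on
        thag_edges_flat_iff thag_contraction_poly_thag_edges rank_thag_edges_False)
  qed
  finally show ?thesis by (simp only: thag_inverse_KL_equation[OF S])
qed

lemma inverse_KL_thagomizer_on:
  assumes "finite S"
  shows "inverse_KL (thagomizer_on S) = thag_inverse_KL (card S)"
  using assms
proof (induction S rule: finite_psubset_induct)
  case (psubset S)
  note S = psubset.hyps
  let ?M = "thagomizer_on S"
  interpret finite_matroid ?M using S by (rule finite_matroid_thagomizer_on)
  have ground: "flat_inverse_KL (ground ?M) = thag_inverse_KL (card S)"
    by (simp add: ground_thagomizer_on flat_inverse_KL_thag_edges)
  have "inverse_KL ?M = flat_inverse_KL (ground ?M)"
  proof (rule inverse_KL_eqI)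
    show "2 * degree (flat_inverse_KL (ground ?M)) < rk ?M"
      using degree_thag_inverse_KL[of "card S"] by (simp add: ground rk_thagomizer_on[OF S])
    show "(-1) ^ rk ?M * reversal (rk ?M) (flat_inverse_KL (ground ?M)) =
        (\<Sum>F\<in>flats ?M. (-1) ^ rank F * flat_inverse_KL F * rev_char_poly (contraction ?M F))"
      by (simp only: ground rk_thagomizer_on[OF S] sum_flats_flat_inverse_KL[OF S])
    fix F assume F: "F \<in> flats ?M" "F \<noteq> ground ?M"
    from S F(1) show "inverse_KL (restriction ?M F) = flat_inverse_KL F"
    proof (cases rule: flats_thagomizer_on_cases)
      case (with_AB T)
      then have "T \<subset> S" using F(2) by (auto simp: ground_thagomizer_on)
      then show ?thesis
        using with_AB psubset.IH by (simp add: flat_inverse_KL_thag_edges restriction_thagomizer_on)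
    next
      case (without_AB P Q)
      then have "finite (thag_edges False P Q)"
        using finite_subset[OF _ S] by (simp add: finite_thag_edges)
      then show ?thesis
        using without_AB S
        by (simp add: flat_inverse_KL_thag_edges restriction_thag_edges_False inverse_KL_boolean)
    qed
  qed
  then show ?case by (simp only: ground)
qed

lemma coeff_thag_inverse_KL:
  "of_int (coeff (thag_inverse_KL n) k) = (\<Sum>i = 2 * k..n.
     of_nat (n - i + 1) / of_nat (n + 1) *
     (fact (n + 1) / (fact k * fact (i - 2 * k) * fact (n + k - i + 1))) :: 'a::field_char_0)"
proof -
  have "of_int (coeff (thag_inverse_KL n) k) =
      (\<Sum>s\<le>n. of_nat (n choose s) * (of_int (coeff (ballot_poly s) k) :: 'a))"
    by (simp add: thag_inverse_KL_def coeff_sum of_nat_poly)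
  also have "\<dots> = (\<Sum>s\<in>{2 * k..n}. of_nat (n choose s) * of_int (coeff (ballot_poly s) k))"
    by (rule sum.mono_neutral_right) (auto simp: ballot_poly_def coeff_poly_cutoff)
  also have "\<dots> = (\<Sum>i = 2 * k..n. of_nat (n - i + 1) / of_nat (n + 1) *
     (fact (n + 1) / (fact k * fact (i - 2 * k) * fact (n + k - i + 1))))"
  proof (rule sum.reindex_bij_witness[of _ "\<lambda>i. n + 2 * k - i" "\<lambda>s. n + 2 * k - s"])
    fix s assume s: "s \<in> {2 * k..n}"
    then have "n - (n + 2 * k - s) = s - 2 * k" "n + 2 * k - s - 2 * k = n - s"
      "n + k - (n + 2 * k - s) = s - k" by auto
    then show "of_nat (n - (n + 2 * k - s) + 1) / of_nat (n + 1) * (fact (n + 1) /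
        (fact k * fact (n + 2 * k - s - 2 * k) * fact (n + k - (n + 2 * k - s) + 1))) =
        of_nat (n choose s) * (of_int (coeff (ballot_poly s) k) :: 'a)"
      using s by (simp only: binomial_times_ballot_coeff atLeastAtMost_iff)
  qed auto
  finally show ?thesis .
qed

theorem theorem1p2:
  fixes n :: nat
  shows "map_poly rat_of_int (inverse_KL (thagomizer n)) =
    (\<Sum>k = 0..n div 2. \<Sum>i = 2 * k..n.
       monom (of_nat (n - i + 1) / of_nat (n + 1)
         * (fact (n + 1) / (fact k * fact (i - 2 * k) * fact (n + k - i + 1)))) k)"
proof -
  have "thagomizer n = thagomizer_on {1..n}"
    by (simp add: thagomizer_def thagomizer_on_def thagomizer_graph_eq_thag_edges)
  then have "inverse_KL (thagomizer n) = thag_inverse_KL n"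
    by (simp add: inverse_KL_thagomizer_on)
  moreover have "map_poly rat_of_int (thag_inverse_KL n) =
      (\<Sum>k\<le>n div 2. monom (coeff (map_poly rat_of_int (thag_inverse_KL n)) k) k)"
    by (rule poly_as_sum_of_monoms'[symmetric]) (simp add: degree_map_poly degree_thag_inverse_KL)
  ultimately have "map_poly rat_of_int (inverse_KL (thagomizer n)) =
      (\<Sum>k = 0..n div 2. monom (of_int (coeff (thag_inverse_KL n) k)) k)"
    by (simp add: coeff_map_poly atMost_atLeast0)
  then show ?thesis by (simp only: coeff_thag_inverse_KL monom_sum)
qed

end
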